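(* Let $p$ be an odd prime and let $(G,H,T)$ be the envelope of a right conjugacy closed loop of order $2p$. Then there is a subgroup $K\le G$ with $H\le K$ and $|G:K|=2$, and one of the following occurs: (a) $G$ is isomorphic to the wreath product $C_p\wr C_2$; (b) $G$ is isomorphic to a subgroup of the affine group $\mathrm{Aff}(1,p)$; (c) $G=K\times\langle a\rangle$ for some $a\in G$, and $K$ has odd order and is isomorphic to a subgroup of $\mathrm{Aff}(1,p)$. In cases (b) and (c), $\langle T\cap K\rangle$ is a normal subgroup of $G$ of order $p$. The cases (a), (b), (c) are mutually exclusive.
   Context: All loops are finite. For a loop $\mathcal{L}$ with identity $e$ and right multiplications $R_a\colon x\mapsto x*a$, the right multiplication group is $G=\langle R_a\mid a\in\mathcal{L}\rangle\le \mathrm{Sym}(\mathcal{L})$, $H$ is the stabilizer of $e$ in $G$, and $T=\{R_a\mid a\in\mathcal{L}\}$; $(G,H,T)$ is the envelope of $\mathcal{L}$. The loop is right conjugacy closed if $T$ is a union of conjugacy classes of $G$. $C_n$ denotes the cyclic group of order $n$ and $\mathrm{Aff}(1,p)$ the affine group of the line over $\mathbb{F}_p$. *)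

theory Defs
  imports "HOL-Algebra.Algebra"
begin

definition loop :: "'a set \<Rightarrow> ('a \<Rightarrow> 'a \<Rightarrow> 'a) \<Rightarrow> 'a \<Rightarrow> bool" where
  "loop L m e \<longleftrightarrow> e \<in> L \<and> (\<forall>x\<in>L. \<forall>y\<in>L. m x y \<in> L)
     \<and> (\<forall>x\<in>L. m e x = x \<and> m x e = x)
     \<and> (\<forall>a\<in>L. bij_betw (\<lambda>x. m x a) L L \<and> bij_betw (\<lambda>x. m a x) L L)"

text \<open>Right multiplication R_a as an element of Sym(L) (extensional outside L).\<close>
definition rmult :: "'a set \<Rightarrow> ('a \<Rightarrow> 'a \<Rightarrow> 'a) \<Rightarrow> 'a \<Rightarrow> ('a \<Rightarrow> 'a)" where
  "rmult L m a = restrict (\<lambda>x. m x a) L"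

definition env_T :: "'a set \<Rightarrow> ('a \<Rightarrow> 'a \<Rightarrow> 'a) \<Rightarrow> ('a \<Rightarrow> 'a) set" where
  "env_T L m = rmult L m ` L"

definition env_G :: "'a set \<Rightarrow> ('a \<Rightarrow> 'a \<Rightarrow> 'a) \<Rightarrow> ('a \<Rightarrow> 'a) monoid" where
  "env_G L m = (BijGroup L) \<lparr>carrier := generate (BijGroup L) (env_T L m)\<rparr>"

definition env_H :: "'a set \<Rightarrow> ('a \<Rightarrow> 'a \<Rightarrow> 'a) \<Rightarrow> 'a \<Rightarrow> ('a \<Rightarrow> 'a) set" where
  "env_H L m e = {g \<in> carrier (env_G L m). g e = e}"

definition right_conjugacy_closed :: "'a set \<Rightarrow> ('a \<Rightarrow> 'a \<Rightarrow> 'a) \<Rightarrow> bool" where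
  "right_conjugacy_closed L m \<longleftrightarrow>
     (\<forall>g\<in>carrier (env_G L m). \<forall>t\<in>env_T L m.
        g \<otimes>\<^bsub>env_G L m\<^esub> t \<otimes>\<^bsub>env_G L m\<^esub> inv\<^bsub>env_G L m\<^esub> g \<in> env_T L m)"

text \<open>Wreath product C_p wr C_2 = (C_p x C_p) semidirect C_2, C_2 swapping coordinates.\<close>
definition wreath_mult :: "nat \<Rightarrow> (int \<times> int) \<times> bool \<Rightarrow> (int \<times> int) \<times> bool \<Rightarrow> (int \<times> int) \<times> bool" where
  "wreath_mult p g h =
     (let (x1, y1) = fst g; (x2, y2) = fst h;
          (u, v) = (if snd g then (y2, x2) else (x2, y2))
      in (((x1 + u) mod int p, (y1 + v) mod int p), snd g \<noteq> snd h))"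

definition wreath_Cp_C2 :: "nat \<Rightarrow> ((int \<times> int) \<times> bool) monoid" where
  "wreath_Cp_C2 p = \<lparr>carrier = ({0..<int p} \<times> {0..<int p}) \<times> UNIV,
     monoid.mult = wreath_mult p, one = ((0, 0), False)\<rparr>"

text \<open>Affine group Aff(1,p): maps x \<mapsto> a*x + b over F_p, a \<noteq> 0, under composition.\<close>
definition affine_group :: "nat \<Rightarrow> (int \<times> int) monoid" where
  "affine_group p = \<lparr>carrier = {1..<int p} \<times> {0..<int p},
     monoid.mult = (\<lambda>(a, b) (c, d). ((a * c) mod int p, (a * d + b) mod int p)),
     one = (1, 0)\<rparr>"

definition iso_to_subgroup :: "('a, 'c) monoid_scheme \<Rightarrow> ('b, 'd) monoid_scheme \<Rightarrow> bool" where
  "iso_to_subgroup G A \<longleftrightarrow> (\<exists>S. subgroup S A \<and> G \<cong> A\<lparr>carrier := S\<rparr>)"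

end

(*
  T is a conjugation-invariant, sharply transitive subset of G. Let x be an element of G of order p.
  Conjugation by x permutes the 2p elements of T and fixes 1, so the elements of T that do not
  commute with x, if any, form a single x-orbit of length p.

  If x can be chosen with a fixed point, it is a p-cycle; the elements of T commuting with x preserve
  Fix x and the others interchange it with its complement. Comparing the action of x and of a
  T-conjugate y of x on the orbit of the latter shows that G = <x, y> : 2 is a wreath product.

  Otherwise the centralizer of x is semiregular of order p or 2p, and <x> is the only subgroup of
  order p: a second one would force p = 3, which is excluded by hand. The two orbits of <x> are then
  blocks; numbering both orbits by Z/p, g acts as i -> a(g) i + b_k(g) on orbit k, and
  g -> (a(g), b_1(g) + b_2(g)) is a homomorphism to Aff(1,p) whose kernel centralizes x and meets <x>
  trivially. The kernel is trivial (case (b)) or generated by a central involution outside K (case (c)).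
*)
theory Submission
  imports Defs "HOL-Number_Theory.Residues"
begin

text \<open>Everything rests on one rigidity: an element of \<open>T\<close> is determined by its
  value at a single point. Hence a conjugate of t that agrees with t anywhere is t, and, as the
  identity lies in \<open>T\<close> and \<open>T\<close> has 2p elements, exactly p of them commute
  with an element x of order p unless all do. This is how the hypothesis, which speaks only of
  \<open>T\<close>, gives information on the centralizer of x. The p-part of the order of G is not
  bounded in advance, so uniqueness of the subgroup of order p has to come from counting in
  \<open>T\<close> as well.

  In both branches K is the stabilizer of the half of the points that contains the identity e of the
  loop: \<open>Fix x\<close> or its complement in one, the <x>-orbit of e in the other. So H lies in
  K at once.

  The cases are separated as follows. In (a) every subgroup of index 2 has order p^2, which does not
  divide |Aff(1,p)| = p(p-1). In (c) an involution commutes with an element of order p, which never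
  happens in Aff(1,p).\<close>

section \<open>Cyclic groups of prime order\<close>

text \<open>An action of Z/p, indexed by all integers to avoid reductions modulo p. The carrier
  \<open>Y\<close> is left open because powers of one element act on the points, on \<open>T\<close>
  by conjugation, and on all of G by conjugation.\<close>

locale prime_cyclic_action =
  fixes p :: nat and Y :: "'b set" and f :: "int \<Rightarrow> 'b \<Rightarrow> 'b"
  assumes prime_p: "Factorial_Ring.prime p" and finite_Y: "finite Y"
    and closed: "v \<in> Y \<Longrightarrow> f i v \<in> Y"
    and zero: "v \<in> Y \<Longrightarrow> f 0 v = v"
    and add: "v \<in> Y \<Longrightarrow> f (i + j) v = f i (f j v)"
    and period: "v \<in> Y \<Longrightarrow> f (int p) v = v"
begin

definition orb :: "'b \<Rightarrow> 'b set" where "orb v = range (\<lambda>i. f i v)"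

lemma fixed_mult: "v \<in> Y \<Longrightarrow> f k v = v \<Longrightarrow> f (k * l) v = v"
proof -
  assume v: "v \<in> Y" "f k v = v"
  have n: "f (k * int n) v = v" for n
    by (induction n) (simp_all add: v zero add distrib_left)
  have "f (- (k * int n)) v = v" for n
    using add[OF v(1), of "- (k * int n)" "k * int n"] n[of n] zero[OF v(1)] by simp
  then show "f (k * l) v = v"
    using n by (cases l rule: int_cases2) auto
qed

text \<open>As p is prime, Bezout writes every l as a combination of k and p, and multiples of both
  fix v.\<close>

lemma fixed_power:
  assumes v: "v \<in> Y" and k: "\<not> int p dvd k" "f k v = v"
  shows "f l v = v"
proof -
  have "coprime k (int p)"
    using k(1) prime_p by (metis prime_imp_coprime_int prime_nat_int_transfer coprime_commute)
  then obtain a b where "a * k + b * int p = 1"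
    by (metis bezout_int coprime_imp_gcd_eq_1)
  then have "l = (a * k + b * int p) * l"
    by simp
  then have l: "l = k * (a * l) + int p * (b * l)"
    by (simp add: algebra_simps)
  have "f (k * (a * l) + int p * (b * l)) v = v"
    using v fixed_mult[OF v k(2)] fixed_mult[OF v period[OF v]] by (simp only: add)
  then show ?thesis using l by simp
qed

lemma cancel: "v \<in> Y \<Longrightarrow> w \<in> Y \<Longrightarrow> f i v = f i w \<Longrightarrow> v = w"
  by (metis add add.left_inverse zero)

lemma eq_iff_dvd:
  assumes v: "v \<in> Y" "f 1 v \<noteq> v"
  shows "f i v = f j v \<longleftrightarrow> int p dvd (i - j)"
proof -
  have "f i v = f j v \<longleftrightarrow> f (i - j) v = v"
    using add[OF v(1), of j "i - j"] cancel[of v "f (i - j) v" j] closed v by auto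
  also have "\<dots> \<longleftrightarrow> int p dvd (i - j)"
    using fixed_power[of v "i - j" 1] fixed_mult[OF v(1) period[OF v(1)]] v by (auto elim: dvdE)
  finally show ?thesis .
qed

lemma card_orb:
  assumes v: "v \<in> Y" "f 1 v \<noteq> v"
  shows "card (orb v) = p"
proof -
  have p: "0 < p" using prime_p prime_gt_0_nat by blast
  have "orb v = (\<lambda>i. f i v) ` {0..<int p}"
  proof -
    have "f i v \<in> (\<lambda>i. f i v) ` {0..<int p}" for i
    proof (rule image_eqI)
      show "f i v = f (i mod int p) v"
        using eq_iff_dvd[OF v, of i "i mod int p"] by (simp add: minus_mod_eq_mult_div)
    qed (use p in simp)
    then show ?thesis unfolding orb_def by auto
  qed
  moreover have "inj_on (\<lambda>i. f i v) {0..<int p}"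
    by (rule inj_onI) (simp add: eq_iff_dvd[OF v] mod_eq_dvd_iff[symmetric])
  ultimately show ?thesis by (simp add: card_image)
qed

lemma orb_subset: "v \<in> Y \<Longrightarrow> orb v \<subseteq> Y"
  by (auto simp: orb_def closed)

lemma self_in_orb: "v \<in> Y \<Longrightarrow> v \<in> orb v"
  unfolding orb_def using zero by (metis rangeI)

lemma orb_closed: "v \<in> Y \<Longrightarrow> w \<in> orb v \<Longrightarrow> f i w \<in> orb v"
  unfolding orb_def by (auto simp flip: add)

lemma orb_sym: "v \<in> Y \<Longrightarrow> w \<in> orb v \<Longrightarrow> v \<in> orb w"
  unfolding orb_def by (metis (no_types, lifting) add add.left_inverse rangeE rangeI zero)

lemma orb_eq:
  assumes "v \<in> Y" "w \<in> orb v"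
  shows "orb w = orb v"
proof
  have w: "w \<in> Y" using assms orb_subset by blast
  show "orb w \<subseteq> orb v" using orb_closed[OF assms] by (auto simp: orb_def[of w])
  show "orb v \<subseteq> orb w" using orb_closed[OF w orb_sym[OF assms]] by (auto simp: orb_def[of v])
qed

lemma orb_disjoint:
  assumes "v \<in> Y" "w \<in> Y" "w \<notin> orb v"
  shows "orb v \<inter> orb w = {}"
proof (rule ccontr)
  assume "orb v \<inter> orb w \<noteq> {}"
  then obtain u where "u \<in> orb v" "u \<in> orb w" by blast
  moreover from this obtain i where "u = f i w" unfolding orb_def by blast
  ultimately have "f i w \<in> orb v" by simp
  then have "f (- i) (f i w) \<in> orb v" using orb_closed assms by blast
  then show False using assms by (simp flip: add add: zero)
qed

lemma moved_orb: "v \<in> Y \<Longrightarrow> f 1 v \<noteq> v \<Longrightarrow> w \<in> orb v \<Longrightarrow> f 1 w \<noteq> w"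
  unfolding orb_def using prime_p
  by (auto simp flip: add simp: eq_iff_dvd prime_nat_iff)

lemma two_orbs:
  assumes Y: "card Y = 2 * p" and v: "v \<in> Y" "f 1 v \<noteq> v" and w: "w \<in> Y" "f 1 w \<noteq> w"
    and "w \<notin> orb v"
  shows "Y = orb v \<union> orb w"
proof -
  have "card (orb v \<union> orb w) = card Y"
    using assms orb_disjoint[of v w] finite_subset[OF orb_subset finite_Y]
    by (subst card_Un_disjoint) (auto simp: card_orb)
  then show ?thesis
    using card_subset_eq[of Y "orb v \<union> orb w"] orb_subset v w finite_Y by blast
qed

text \<open>A second non-trivial orbit would use up all 2p points together with the first and leave
  no room for the fixed point z.\<close>

lemma moved_eq_orb:
  assumes Y: "card Y = 2 * p" and z: "z \<in> Y" "f 1 z = z" and v: "v \<in> Y" "f 1 v \<noteq> v"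
  shows "{w \<in> Y. f 1 w \<noteq> w} = orb v"
proof -
  have "w \<in> orb v" if w: "w \<in> Y" "f 1 w \<noteq> w" for w
  proof (rule ccontr)
    assume "w \<notin> orb v"
    then have "z \<in> orb v \<union> orb w" using two_orbs[OF Y v w] z by blast
    then show False using moved_orb[OF v] moved_orb[OF w] z(2) by blast
  qed
  then show ?thesis using moved_orb[OF v] orb_subset[OF v(1)] by blast
qed

end

section \<open>Conjugation, elements of prime order and subgroups of index two\<close>

context group
begin

lemma prime_ord:
  assumes "x \<in> carrier G" "x [^] p = \<one>" "x \<noteq> \<one>" "Factorial_Ring.prime (p::nat)"
  shows "ord x = p"
  using assms by (metis ord_eq_1 pow_eq_id prime_nat_iff)

lemma conj_int_pow:
  assumes "g \<in> carrier G" "x \<in> carrier G"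
  shows "(g \<otimes> x \<otimes> inv g) [^] (i::int) = g \<otimes> x [^] i \<otimes> inv g"
proof -
  have n: "(g \<otimes> x \<otimes> inv g) [^] (n::nat) = g \<otimes> x [^] n \<otimes> inv g" for n
  proof (induction n)
    case (Suc n)
    have "(g \<otimes> x [^] n \<otimes> inv g) \<otimes> (g \<otimes> x \<otimes> inv g) = g \<otimes> x [^] n \<otimes> (inv g \<otimes> g) \<otimes> x \<otimes> inv g"
      using assms by (simp only: m_assoc m_closed inv_closed nat_pow_closed)
    also have "\<dots> = g \<otimes> x [^] Suc n \<otimes> inv g"
      using assms by (simp add: m_assoc)
    finally show ?case
      by (simp only: nat_pow_Suc[of "g \<otimes> x \<otimes> inv g"] Suc)
  qed (use assms in simp)
  have "inv (g \<otimes> x [^] n \<otimes> inv g) = g \<otimes> inv (x [^] n) \<otimes> inv g" for n :: nat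
    using assms by (simp add: inv_mult_group m_assoc)
  with n show ?thesis
    using assms by (cases i rule: int_cases2) (simp_all add: int_pow_int int_pow_neg_int)
qed

lemma conj_eq_iff:
  assumes "g \<in> carrier G" "x \<in> carrier G" "y \<in> carrier G"
  shows "g \<otimes> x \<otimes> inv g = y \<longleftrightarrow> g \<otimes> x = y \<otimes> g"
  using assms by (metis inv_solve_right m_closed)

lemma int_pow_commute:
  assumes "x \<in> carrier G" "y \<in> carrier G" "x \<otimes> y = y \<otimes> x"
  shows "x [^] (i::int) \<otimes> y = y \<otimes> x [^] i"
proof -
  have "y \<otimes> x \<otimes> inv y = x"
    using assms by (simp add: conj_eq_iff)
  then have "y \<otimes> x [^] i \<otimes> inv y = x [^] i"
    using conj_int_pow[OF assms(2,1), of i] by simp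
  then show ?thesis
    using assms by (simp add: conj_eq_iff)
qed

text \<open>Cauchy's theorem: Sylow's theorem with exponent 1, then Lagrange's theorem inside the
  subgroup of order q.\<close>

lemma exists_prime_order:
  assumes q: "Factorial_Ring.prime q" "q dvd order G" and fin: "finite (carrier G)"
  shows "\<exists>x\<in>carrier G. x \<noteq> \<one> \<and> x [^] (q::nat) = \<one>"
proof -
  obtain n where "order G = q ^ 1 * n" using q(2) by auto
  then obtain H where H: "subgroup H G" "card H = q ^ 1"
    using sylow_thm[OF q(1) group_axioms _ fin] by blast
  have "H \<noteq> {\<one>}" using H(2) prime_gt_1_nat[OF q(1)] by auto
  then obtain x where x: "x \<in> H" "x \<noteq> \<one>" using subgroup.one_closed[OF H(1)] by blast
  interpret H: group "G\<lparr>carrier := H\<rparr>" using H(1) by (rule subgroup_imp_group)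
  have "x [^]\<^bsub>G\<lparr>carrier := H\<rparr>\<^esub> order (G\<lparr>carrier := H\<rparr>) = \<one>"
    using H.pow_order_eq_1[of x] x by simp
  then have "x [^] q = \<one>"
    using H(2) by (simp add: order_def flip: nat_pow_consistent)
  then show ?thesis using x subgroup.mem_carrier[OF H(1)] by blast
qed

text \<open>The hypothesis \<open>mult\<close> makes membership in K a homomorphism to a group of
  order 2 with kernel K, and a shows that it is onto.\<close>

lemma index_two:
  assumes K: "K \<subseteq> carrier G" "\<one> \<in> K" and a: "a \<in> carrier G" "a \<notin> K"
    and mult: "\<And>g h. g \<in> carrier G \<Longrightarrow> h \<in> carrier G \<Longrightarrow> g \<otimes> h \<in> K \<longleftrightarrow> (g \<in> K \<longleftrightarrow> h \<in> K)"
  shows "K \<lhd> G" "card (rcosets K) = 2"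
proof -
  have inv: "inv g \<in> K \<longleftrightarrow> g \<in> K" if "g \<in> carrier G" for g
    using mult[of g "inv g"] K that by simp
  have "subgroup K G"
    using K mult inv by (intro subgroupI) (auto simp: subset_iff)
  then show "K \<lhd> G"
    using K by (intro normal_invI) (auto simp: mult inv)
  have coset: "K #> b = {g \<in> carrier G. g \<in> K \<longleftrightarrow> b \<in> K}" if b: "b \<in> carrier G" for b
  proof (rule equalityI; rule subsetI)
    fix g assume g: "g \<in> {g \<in> carrier G. g \<in> K \<longleftrightarrow> b \<in> K}"
    then have "g \<otimes> inv b \<in> K" "g = (g \<otimes> inv b) \<otimes> b"
      using b by (auto simp: mult inv m_assoc)
    then show "g \<in> K #> b" unfolding r_coset_def by blast
  qed (use b K in \<open>auto simp: r_coset_def mult\<close>)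
  have "rcosets K = {K, carrier G - K}"
    unfolding RCOSETS_def using coset a K by auto
  moreover have "K \<noteq> carrier G - K" using K by blast
  ultimately show "card (rcosets K) = 2" by simp
qed

end

section \<open>Invariant transversals\<close>

text \<open>The envelope without its loop. \<open>T_sharp\<close> is left division: \<alpha> * a =
  \<beta> has exactly one solution a. Asking for it at every \<alpha>, not only at the identity of
  the loop, puts all points on the same footing.\<close>

locale conj_closed_transversal = group G for G (structure) +
  fixes act :: "'a \<Rightarrow> 'c \<Rightarrow> 'c" and Om :: "'c set" and T :: "'a set" and p :: nat
  assumes act_closed [simp]: "g \<in> carrier G \<Longrightarrow> \<alpha> \<in> Om \<Longrightarrow> act g \<alpha> \<in> Om"
    and act_mult [simp]: "g \<in> carrier G \<Longrightarrow> h \<in> carrier G \<Longrightarrow> \<alpha> \<in> Om \<Longrightarrow>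
      act (g \<otimes> h) \<alpha> = act g (act h \<alpha>)"
    and act_one [simp]: "\<alpha> \<in> Om \<Longrightarrow> act \<one> \<alpha> = \<alpha>"
    and faithful: "g \<in> carrier G \<Longrightarrow> h \<in> carrier G \<Longrightarrow> (\<And>\<alpha>. \<alpha> \<in> Om \<Longrightarrow> act g \<alpha> = act h \<alpha>) \<Longrightarrow> g = h"
    and T_subset: "T \<subseteq> carrier G" and generate_T: "generate G T = carrier G"
    and T_conj: "g \<in> carrier G \<Longrightarrow> t \<in> T \<Longrightarrow> g \<otimes> t \<otimes> inv g \<in> T"
    and T_sharp: "\<alpha> \<in> Om \<Longrightarrow> \<beta> \<in> Om \<Longrightarrow> \<exists>!t. t \<in> T \<and> act t \<alpha> = \<beta>"
    and one_in_T: "\<one> \<in> T"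
    and prime_p: "Factorial_Ring.prime p" and odd_p: "odd p"
    and finite_carrier: "finite (carrier G)"
    and card_Om: "card Om = 2 * p"
begin

lemma T_carrier [simp]: "t \<in> T \<Longrightarrow> t \<in> carrier G"
  using T_subset by blast

lemma p_ge3: "p \<ge> 3"
  using prime_gt_1_nat[OF prime_p] odd_p by (cases "p = 2") auto

lemma finite_Om: "finite Om"
  using card_Om p_ge3 by (intro card_ge_0_finite) simp

lemma finite_T: "finite T"
  using finite_subset[OF T_subset finite_carrier] .

lemma T_eqI: "s \<in> T \<Longrightarrow> t \<in> T \<Longrightarrow> \<alpha> \<in> Om \<Longrightarrow> act s \<alpha> = act t \<alpha> \<Longrightarrow> s = t"
  using T_sharp[of \<alpha> "act t \<alpha>"] by auto

lemma T_bij: "\<alpha> \<in> Om \<Longrightarrow> bij_betw (\<lambda>t. act t \<alpha>) T Om"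
proof (rule bij_betw_imageI)
  assume \<alpha>: "\<alpha> \<in> Om"
  then show "inj_on (\<lambda>t. act t \<alpha>) T"
    using T_eqI by (intro inj_onI) blast
  have "\<beta> \<in> (\<lambda>t. act t \<alpha>) ` T" if "\<beta> \<in> Om" for \<beta>
    using T_sharp[OF \<alpha> that] by blast
  then show "(\<lambda>t. act t \<alpha>) ` T = Om"
    using \<alpha> by auto
qed

lemma card_T: "card T = 2 * p"
proof -
  obtain \<alpha> where "\<alpha> \<in> Om" using card_Om p_ge3 by fastforce
  then show ?thesis using bij_betw_same_card[OF T_bij] card_Om by simp
qed

lemma act_inv [simp]: "g \<in> carrier G \<Longrightarrow> \<alpha> \<in> Om \<Longrightarrow> act (inv g) (act g \<alpha>) = \<alpha>"
  by (simp flip: act_mult)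

lemma act_inv' [simp]: "g \<in> carrier G \<Longrightarrow> \<alpha> \<in> Om \<Longrightarrow> act g (act (inv g) \<alpha>) = \<alpha>"
  by (simp flip: act_mult)

lemma act_inj: "g \<in> carrier G \<Longrightarrow> \<alpha> \<in> Om \<Longrightarrow> \<beta> \<in> Om \<Longrightarrow> act g \<alpha> = act g \<beta> \<longleftrightarrow> \<alpha> = \<beta>"
  by (metis act_inv)

lemma subgroup_of_T: "subgroup S G \<Longrightarrow> T \<subseteq> S \<Longrightarrow> S = carrier G"
  using generate_subgroup_incl[of T S] generate_T subgroup.subset by blast

text \<open>The centralizer of x is a subgroup and \<open>T\<close> generates G. Read
  contrapositively, it supplies an element of \<open>T\<close> that does not commute with a given
  non-central x.\<close>

lemma commute_all:
  assumes "x \<in> carrier G" "\<And>t. t \<in> T \<Longrightarrow> t \<otimes> x = x \<otimes> t" "g \<in> carrier G"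
  shows "g \<otimes> x = x \<otimes> g"
proof -
  have "subgroup {g \<in> carrier G. g \<otimes> x = x \<otimes> g} G"
  proof (rule subgroupI)
    fix a assume "a \<in> {g \<in> carrier G. g \<otimes> x = x \<otimes> g}"
    then show "inv a \<in> {g \<in> carrier G. g \<otimes> x = x \<otimes> g}"
      using assms(1) by (auto simp: inv_solve_left' inv_solve_right' m_assoc)
       (metis assms(1) inv_closed inv_solve_right m_assoc m_closed)
  next
    fix a b assume "a \<in> {g \<in> carrier G. g \<otimes> x = x \<otimes> g}" "b \<in> {g \<in> carrier G. g \<otimes> x = x \<otimes> g}"
    then show "a \<otimes> b \<in> {g \<in> carrier G. g \<otimes> x = x \<otimes> g}"
      using assms(1) by auto (metis m_assoc)
  qed (use assms in auto)
  then show ?thesis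
    using subgroup_of_T[of "{g \<in> carrier G. g \<otimes> x = x \<otimes> g}"] assms T_subset by blast
qed

text \<open>\<open>T\<close> is a transversal of the stabilizer H of a point: each element is
  uniquely t h, so the order of G is 2p |H|.\<close>

lemma p_dvd_order: "p dvd order G"
proof -
  obtain \<alpha> where \<alpha>: "\<alpha> \<in> Om" using card_Om p_ge3 by fastforce
  define H where "H = {h \<in> carrier G. act h \<alpha> = \<alpha>}"
  have "bij_betw (\<lambda>(t, h). t \<otimes> h) (T \<times> H) (carrier G)"
    unfolding bij_betw_def
  proof
    show "inj_on (\<lambda>(t, h). t \<otimes> h) (T \<times> H)"
    proof (rule inj_onI, clarify)
      fix s h t k assume *: "s \<in> T" "t \<in> T" "h \<in> H" "k \<in> H" "s \<otimes> h = t \<otimes> k"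
      then have "act (s \<otimes> h) \<alpha> = act (t \<otimes> k) \<alpha>" by simp
      then have "act s \<alpha> = act t \<alpha>"
        using *(1-4) \<alpha> by (simp add: H_def)
      then have "s = t" using * \<alpha> T_eqI by (simp add: H_def)
      then show "s = t \<and> h = k" using * by (auto simp: H_def)
    qed
    have "g \<in> (\<lambda>(t, h). t \<otimes> h) ` (T \<times> H)" if g: "g \<in> carrier G" for g
    proof -
      obtain t where t: "t \<in> T" "act t \<alpha> = act g \<alpha>" using T_sharp[of \<alpha> "act g \<alpha>"] \<alpha> g by auto
      then have "inv t \<otimes> g \<in> H" "g = t \<otimes> (inv t \<otimes> g)"
        using g \<alpha> t(2)[symmetric] by (auto simp: H_def m_assoc[symmetric])
      then show ?thesis using t(1) by force
    qed
    then show "(\<lambda>(t, h). t \<otimes> h) ` (T \<times> H) = carrier G" by (auto simp: H_def)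
  qed
  then have "order G = card (T \<times> H)"
    by (simp add: order_def bij_betw_same_card)
  then show ?thesis by (simp add: card_T card_cartesian_product)
qed

lemma prime_action:
  assumes x: "x \<in> carrier G" "x [^] p = \<one>"
  shows "prime_cyclic_action p Om (\<lambda>i. act (x [^] i))"
  using x by unfold_locales (simp_all add: prime_p finite_Om int_pow_int int_pow_mult)

lemma prime_conj_action:
  assumes x: "x \<in> carrier G" "x [^] p = \<one>"
    and Y: "Y \<subseteq> carrier G" "\<And>y i. y \<in> Y \<Longrightarrow> x [^] (i::int) \<otimes> y \<otimes> inv (x [^] i) \<in> Y"
  shows "prime_cyclic_action p Y (\<lambda>i y. x [^] i \<otimes> y \<otimes> inv (x [^] i))"
proof
  fix v i j assume v: "v \<in> Y"
  then show "x [^] i \<otimes> v \<otimes> inv (x [^] i) \<in> Y" for i :: int by (rule Y(2))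
  have [simp]: "v \<in> carrier G" using v Y(1) by blast
  show "x [^] (0::int) \<otimes> v \<otimes> inv (x [^] (0::int)) = v" by simp
  show "x [^] (i + j) \<otimes> v \<otimes> inv (x [^] (i + j)) =
    x [^] i \<otimes> (x [^] j \<otimes> v \<otimes> inv (x [^] j)) \<otimes> inv (x [^] i)" for i j :: int
    using x by (simp add: int_pow_mult inv_mult_group m_assoc)
  show "x [^] int p \<otimes> v \<otimes> inv (x [^] int p) = v"
    using x by (simp add: int_pow_int)
qed (use prime_p finite_subset[OF Y(1) finite_carrier] in auto)

abbreviation orbit :: "'a \<Rightarrow> 'c \<Rightarrow> 'c set" where
  "orbit x \<alpha> \<equiv> range (\<lambda>i::int. act (x [^] i) \<alpha>)"

text \<open>The fixed point required by \<open>moved_eq_orb\<close> is the identity, which lies in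
  \<open>T\<close>. The last count is the starting point of \<open>prime_order_unique\<close> and
  reappears in \<open>odd_card_K\<close>.\<close>

lemma T_noncommuting_orbit:
  assumes x: "x \<in> carrier G" "x [^] p = \<one>" and u: "u \<in> T" "u \<otimes> x \<noteq> x \<otimes> u"
  shows "{t \<in> T. t \<otimes> x \<noteq> x \<otimes> t} = range (\<lambda>i::int. x [^] i \<otimes> u \<otimes> inv (x [^] i))"
    and "card {t \<in> T. t \<otimes> x \<noteq> x \<otimes> t} = p"
    and "card {t \<in> T. t \<otimes> x = x \<otimes> t} = p"
proof -
  interpret C: prime_cyclic_action p T "\<lambda>i y. x [^] i \<otimes> y \<otimes> inv (x [^] i)"
    using x by (intro prime_conj_action) (auto intro: T_conj)
  have comm: "x [^] (1::int) \<otimes> t \<otimes> inv (x [^] (1::int)) = t \<longleftrightarrow> t \<otimes> x = x \<otimes> t"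
    if "t \<in> T" for t
    using x that by (simp add: conj_eq_iff) metis
  have moved: "{t \<in> T. t \<otimes> x \<noteq> x \<otimes> t} = {t \<in> T. x [^] (1::int) \<otimes> t \<otimes> inv (x [^] (1::int)) \<noteq> t}"
    using comm by blast
  have "\<dots> = C.orb u"
    using card_T one_in_T u x comm by (intro C.moved_eq_orb[of \<one> u]) auto
  with moved show 1: "{t \<in> T. t \<otimes> x \<noteq> x \<otimes> t} = range (\<lambda>i::int. x [^] i \<otimes> u \<otimes> inv (x [^] i))"
    by (simp add: C.orb_def)
  show 2: "card {t \<in> T. t \<otimes> x \<noteq> x \<otimes> t} = p"
    using C.card_orb[of u] u comm 1 by (simp add: C.orb_def)
  have "card T = card {t \<in> T. t \<otimes> x \<noteq> x \<otimes> t} + card {t \<in> T. t \<otimes> x = x \<otimes> t}"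
    using finite_T by (subst card_Un_disjoint[symmetric]) (auto intro: arg_cong[where f=card])
  then show "card {t \<in> T. t \<otimes> x = x \<otimes> t} = p"
    using 2 card_T by simp
qed

text \<open>The Boolean \<open>b\<close> says whether \<open>g\<close> preserves or interchanges \<open>D\<close> and its complement.\<close>
definition permutes_halves :: "'c set \<Rightarrow> 'a \<Rightarrow> bool" where
  "permutes_halves D g \<longleftrightarrow> (\<exists>b. \<forall>\<alpha>\<in>Om. (act g \<alpha> \<in> D) = ((\<alpha> \<in> D) = b))"

text \<open>Such elements form a subgroup: under composition the Booleans b combine by
  \<open>=\<close>, a group law of order 2 with neutral element \<open>True\<close>.\<close>

lemma permutes_halves_all:
  assumes "\<And>t. t \<in> T \<Longrightarrow> permutes_halves D t" "g \<in> carrier G"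
  shows "permutes_halves D g"
proof -
  have "subgroup {g \<in> carrier G. permutes_halves D g} G"
  proof (rule subgroupI)
    have "permutes_halves D \<one>" unfolding permutes_halves_def by (rule exI[of _ True]) simp
    then show "{g \<in> carrier G. permutes_halves D g} \<noteq> {}" by blast
  next
    fix a assume a: "a \<in> {g \<in> carrier G. permutes_halves D g}"
    then obtain b where b: "\<And>\<alpha>. \<alpha> \<in> Om \<Longrightarrow> (act a \<alpha> \<in> D) = ((\<alpha> \<in> D) = b)"
      unfolding permutes_halves_def by blast
    have "(act (inv a) \<alpha> \<in> D) = ((\<alpha> \<in> D) = b)" if "\<alpha> \<in> Om" for \<alpha>
      using b[of "act (inv a) \<alpha>"] a that by auto
    then show "inv a \<in> {g \<in> carrier G. permutes_halves D g}"
      using a unfolding permutes_halves_def by blast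
  next
    fix a a' assume a: "a \<in> {g \<in> carrier G. permutes_halves D g}" "a' \<in> {g \<in> carrier G. permutes_halves D g}"
    then have "permutes_halves D a" "permutes_halves D a'" by simp_all
    then obtain b b' where b: "\<forall>\<alpha>\<in>Om. (act a \<alpha> \<in> D) = ((\<alpha> \<in> D) = b)"
      and b': "\<forall>\<alpha>\<in>Om. (act a' \<alpha> \<in> D) = ((\<alpha> \<in> D) = b')"
      unfolding permutes_halves_def by (elim exE)
    have "(act (a \<otimes> a') \<alpha> \<in> D) = ((\<alpha> \<in> D) = (b = b'))" if "\<alpha> \<in> Om" for \<alpha>
      using b[THEN bspec, of "act a' \<alpha>"] b'[THEN bspec, of \<alpha>] a that by (cases b; cases b') simp_all
    then have "permutes_halves D (a \<otimes> a')" unfolding permutes_halves_def by (intro exI ballI)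
    then show "a \<otimes> a' \<in> {g \<in> carrier G. permutes_halves D g}"
      using a by simp
  qed auto
  then show ?thesis
    using subgroup_of_T[of "{g \<in> carrier G. permutes_halves D g}"] assms T_subset by blast
qed

text \<open>If G permutes D and its complement and e lies in D, this is the setwise stabilizer of D.
  Testing only the point e makes it obvious that the stabilizer of e is contained in it.\<close>

definition block_stab :: "'c \<Rightarrow> 'c set \<Rightarrow> 'a set" where
  "block_stab e D = {g \<in> carrier G. act g e \<in> D}"

lemma block_stab_index_two:
  assumes resp: "\<And>g. g \<in> carrier G \<Longrightarrow> permutes_halves D g" and e: "e \<in> Om" "e \<in> D" and f: "f \<in> Om" "f \<notin> D"
  defines "K \<equiv> block_stab e D"
  shows "K \<lhd> G" "card (rcosets K) = 2"
    and "\<And>g h. g \<in> carrier G \<Longrightarrow> h \<in> carrier G \<Longrightarrow> g \<otimes> h \<in> K \<longleftrightarrow> (g \<in> K \<longleftrightarrow> h \<in> K)"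
    and "\<And>g \<alpha>. g \<in> carrier G \<Longrightarrow> \<alpha> \<in> Om \<Longrightarrow> act g \<alpha> \<in> D \<longleftrightarrow> (g \<in> K \<longleftrightarrow> \<alpha> \<in> D)"
proof -
  show act: "\<And>g \<alpha>. g \<in> carrier G \<Longrightarrow> \<alpha> \<in> Om \<Longrightarrow> act g \<alpha> \<in> D \<longleftrightarrow> (g \<in> K \<longleftrightarrow> \<alpha> \<in> D)"
  proof -
    fix g \<alpha> assume "g \<in> carrier G" "\<alpha> \<in> Om"
    then show "act g \<alpha> \<in> D \<longleftrightarrow> (g \<in> K \<longleftrightarrow> \<alpha> \<in> D)"
      using resp[of g] e unfolding permutes_halves_def K_def block_stab_def by auto
  qed
  have K: "g \<in> K \<longleftrightarrow> act g e \<in> D" if "g \<in> carrier G" for g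
    using that by (simp add: K_def block_stab_def)
  show mult: "\<And>g h. g \<in> carrier G \<Longrightarrow> h \<in> carrier G \<Longrightarrow> g \<otimes> h \<in> K \<longleftrightarrow> (g \<in> K \<longleftrightarrow> h \<in> K)"
    using act e K act_mult act_closed m_closed by metis
  obtain a where a: "a \<in> T" "act a e = f" using T_sharp e f by blast
  have "K \<subseteq> carrier G" "\<one> \<in> K" "a \<notin> K" "a \<in> carrier G"
    using e f a by (auto simp: K_def block_stab_def)
  with mult show "K \<lhd> G" "card (rcosets K) = 2"
    using index_two[of K a] by blast+
qed

end

section \<open>The wreath product case\<close>

context group
begin

lemma intertwine_int_pow:
  assumes "s \<in> carrier G" "x \<in> carrier G" "y \<in> carrier G" "s \<otimes> x = y \<otimes> s"
  shows "s \<otimes> x [^] (i::int) = y [^] i \<otimes> s"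
proof -
  have "s \<otimes> x \<otimes> inv s = y" using assms by (intro conj_eq_iff[THEN iffD2])
  then have "s \<otimes> x [^] i \<otimes> inv s = y [^] i" using conj_int_pow[OF assms(1,2), of i] by simp
  then show ?thesis using assms by (simp add: conj_eq_iff)
qed

lemma intertwine_mult:
  assumes "g \<in> carrier G" "h \<in> carrier G" "x \<in> carrier G" "y \<in> carrier G" "z \<in> carrier G"
    and "h \<otimes> x = y \<otimes> h" "g \<otimes> y = z \<otimes> g"
  shows "g \<otimes> h \<otimes> x = z \<otimes> (g \<otimes> h)"
  using assms by (metis m_assoc)

lemma intertwine_inv:
  assumes "g \<in> carrier G" "x \<in> carrier G" "y \<in> carrier G" "g \<otimes> x = y \<otimes> g"
  shows "inv g \<otimes> y = x \<otimes> inv g"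
proof -
  have "x = inv g \<otimes> (y \<otimes> g)" using assms by (simp add: inv_solve_left)
  then show ?thesis using assms by (simp add: m_assoc)
qed

lemma int_pow_mod_period:
  assumes "x \<in> carrier G" "x [^] (p::nat) = \<one>"
  shows "x [^] (i mod int p) = x [^] i"
proof -
  have "x [^] (int p * (i div int p)) = \<one>"
    using assms by (simp add: int_pow_int flip: int_pow_pow)
  then have "x [^] (int p * (i div int p) + i mod int p) = x [^] (i mod int p)"
    using assms(1) by (simp only: int_pow_mult) simp
  then show ?thesis by simp
qed

text \<open>Recognition of the wreath product from within: x and y generate C_p x C_p, and s
  exchanges them. The map is built from the wreath product to G, where the normal form x^i y^j s^b
  is explicit, and then inverted. It is defined on all integer pairs, so multiplicativity needs no
  range conditions.\<close>

lemma iso_wreath_Cp_C2: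
  assumes p: "0 < p" and x: "x \<in> carrier G" "x [^] p = \<one>" and y: "y \<in> carrier G" "y [^] p = \<one>"
    and s: "s \<in> carrier G" "s \<otimes> s = \<one>"
    and comm: "x \<otimes> y = y \<otimes> x" "s \<otimes> x = y \<otimes> s" "s \<otimes> y = x \<otimes> s"
    and indep: "\<And>i j. x [^] (i::int) \<otimes> y [^] (j::int) = \<one> \<Longrightarrow> int p dvd i \<and> int p dvd j"
    and s_notin: "\<And>i j. s \<noteq> x [^] (i::int) \<otimes> y [^] (j::int)"
    and gen: "\<And>g. g \<in> carrier G \<Longrightarrow>
      \<exists>i j. g = x [^] (i::int) \<otimes> y [^] (j::int) \<or> g = x [^] (i::int) \<otimes> y [^] (j::int) \<otimes> s"
  shows "G \<cong> wreath_Cp_C2 p"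
proof -
  let ?W = "wreath_Cp_C2 p"
  define f where "f = (\<lambda>((i, j), b). x [^] (i::int) \<otimes> y [^] (j::int) \<otimes> (if b then s else \<one>))"
  have yx: "y [^] (j::int) \<otimes> x [^] (i::int) = x [^] i \<otimes> y [^] j" for i j
    using intertwine_int_pow[of "y [^] j" x x i] int_pow_commute[of y x j] x(1) y(1) comm(1) by simp
  have sx: "s \<otimes> x [^] (i::int) = y [^] i \<otimes> s" and sy: "s \<otimes> y [^] (i::int) = x [^] i \<otimes> s" for i
    using intertwine_int_pow x(1) y(1) s(1) comm by auto
  have swap: "s \<otimes> (x [^] i \<otimes> y [^] j) = x [^] j \<otimes> y [^] i \<otimes> s" for i j :: int
  proof -
    have "s \<otimes> (x [^] i \<otimes> y [^] j) = (s \<otimes> x [^] i) \<otimes> y [^] j" using x y s by (simp add: m_assoc)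
    also have "\<dots> = y [^] i \<otimes> (s \<otimes> y [^] j)" using x y s by (simp add: sx m_assoc)
    also have "\<dots> = (y [^] i \<otimes> x [^] j) \<otimes> s" using x y s by (simp add: sy m_assoc)
    finally show ?thesis by (simp add: yx)
  qed
  have add: "(x [^] i \<otimes> y [^] j) \<otimes> (x [^] k \<otimes> y [^] l) = x [^] (i + k) \<otimes> y [^] (j + l)" for i j k l :: int
  proof -
    have "(x [^] i \<otimes> y [^] j) \<otimes> (x [^] k \<otimes> y [^] l) = x [^] i \<otimes> (y [^] j \<otimes> x [^] k) \<otimes> y [^] l"
      using x y by (simp add: m_assoc)
    also have "\<dots> = (x [^] i \<otimes> x [^] k) \<otimes> (y [^] j \<otimes> y [^] l)"
      using x y by (simp add: yx m_assoc)
    finally show ?thesis using x y by (simp add: int_pow_mult)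
  qed
  have f_closed: "f a \<in> carrier G" for a
    using x y s by (auto simp: f_def split: prod.splits)
  have f_mult: "f (a \<otimes>\<^bsub>?W\<^esub> b) = f a \<otimes> f b" for a b
  proof -
    obtain i j c k l d where ab: "a = ((i, j), c)" "b = ((k, l), d)" by (metis surj_pair)
    define S where "S b = (if b then s else \<one>)" for b
    have S: "S b \<in> carrier G" for b using s by (simp add: S_def)
    let ?P = "\<lambda>i j. x [^] (i::int) \<otimes> y [^] (j::int)"
    have P: "?P i j \<in> carrier G" for i j using x y by simp
    have 1: "f ((i mod int p, j mod int p), b) = ?P i j \<otimes> S b" for i j b
      using x y by (simp add: f_def S_def int_pow_mod_period)
    \<comment> \<open>Moving s to the right past x^k y^l exchanges k and l; this is the exchange of
      coordinates in \<open>wreath_mult\<close>.\<close>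
    have 2: "?P i j \<otimes> S c \<otimes> (?P k l \<otimes> S d) = (if c then ?P (i + l) (j + k) else ?P (i + k) (j + l)) \<otimes> S (c \<noteq> d)"
    proof (cases c)
      case True
      have "?P i j \<otimes> S c \<otimes> (?P k l \<otimes> S d) = ?P i j \<otimes> (s \<otimes> ?P k l) \<otimes> S d"
        using True P S s by (simp add: S_def m_assoc)
      also have "\<dots> = (?P i j \<otimes> ?P l k) \<otimes> (s \<otimes> S d)"
        unfolding swap using P S s by (simp only: m_assoc m_closed)
      finally show ?thesis unfolding add using True s by (simp add: S_def)
    next
      case False
      have "?P i j \<otimes> S c \<otimes> (?P k l \<otimes> S d) = (?P i j \<otimes> ?P k l) \<otimes> S d"
        using False P S[of d] by (simp add: S_def m_assoc)
      then show ?thesis unfolding add using False by simp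
    qed
    have "a \<otimes>\<^bsub>?W\<^esub> b = (if c then (((i + l) mod int p, (j + k) mod int p), c \<noteq> d)
        else (((i + k) mod int p, (j + l) mod int p), c \<noteq> d))"
      by (simp add: wreath_Cp_C2_def wreath_mult_def ab)
    then have "f (a \<otimes>\<^bsub>?W\<^esub> b) = (if c then ?P (i + l) (j + k) else ?P (i + k) (j + l)) \<otimes> S (c \<noteq> d)"
      by (cases c) (simp_all only: 1 if_True if_False)
    also have "\<dots> = ?P i j \<otimes> S c \<otimes> (?P k l \<otimes> S d)" by (rule 2[symmetric])
    also have "\<dots> = f a \<otimes> f b" by (simp only: ab f_def S_def prod.case)
    finally show ?thesis .
  qed
  have W_closed: "a \<otimes>\<^bsub>?W\<^esub> b \<in> carrier ?W" for a b
    using p by (auto simp: wreath_Cp_C2_def wreath_mult_def Let_def split: prod.splits)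
  have inj: "inj_on f (carrier ?W)"
  proof (rule inj_onI)
    fix a b assume ab: "a \<in> carrier ?W" "b \<in> carrier ?W" "f a = f b"
    obtain i j c k l d where e: "a = ((i, j), c)" "b = ((k, l), d)" by (metis surj_pair)
    let ?P = "\<lambda>i j. x [^] (i::int) \<otimes> y [^] (j::int)"
    have P: "?P i j \<in> carrier G" for i j using x y by simp
    have Pinv: "inv (?P i j) = ?P (- i) (- j)" for i j
      by (rule inv_equality) (simp_all add: add x y)
    \<comment> \<open>If just one of the two normal forms contained s, then s would be a product of
      powers of x and y.\<close>
    have "c = d"
    proof (rule ccontr)
      assume "c \<noteq> d"
      with ab(3) obtain i j k l where "?P i j \<otimes> s = ?P k l"
        unfolding e f_def using P by (cases c; cases d) (auto, metis)
      then have "s = inv (?P i j) \<otimes> ?P k l"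
        using P s by (simp add: inv_solve_left)
      then show False using s_notin unfolding Pinv add by blast
    qed
    then have "?P i j = ?P k l"
      using ab(3) P s by (cases c) (simp_all add: e f_def)
    then have "inv (?P k l) \<otimes> ?P i j = \<one>" using P by simp
    then have "int p dvd (i - k)" "int p dvd (j - l)"
      using indep[of "i - k" "j - l"] unfolding Pinv add by (simp_all add: add.commute)
    then show "a = b"
      using ab(1,2) \<open>c = d\<close> unfolding e wreath_Cp_C2_def
      by (auto simp flip: mod_eq_dvd_iff)
  qed
  have surj: "f ` carrier ?W = carrier G"
  proof -
    have "g \<in> f ` carrier ?W" if g: "g \<in> carrier G" for g
    proof -
      obtain i j where "g = x [^] (i::int) \<otimes> y [^] (j::int) \<or> g = x [^] i \<otimes> y [^] j \<otimes> s"
        using gen[OF g] by blast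
      then obtain c where "g = x [^] (i::int) \<otimes> y [^] (j::int) \<otimes> (if c then s else \<one>)"
        using that[of False] that[of True] x y by auto
      then have "g = f ((i mod int p, j mod int p), c)"
        using x y by (simp add: f_def int_pow_mod_period)
      moreover have "((i mod int p, j mod int p), c) \<in> carrier ?W"
        using p by (simp add: wreath_Cp_C2_def)
      ultimately show ?thesis by blast
    qed
    then show ?thesis using f_closed by blast
  qed
  have "inv_into (carrier ?W) f \<in> iso G ?W"
    unfolding iso_def hom_def
  proof (intro CollectI conjI ballI Pi_I)
    show "bij_betw (inv_into (carrier ?W) f) (carrier G) (carrier ?W)"
      using inj surj by (intro bij_betw_inv_into bij_betw_imageI)
    show "inv_into (carrier ?W) f g \<in> carrier ?W" if "g \<in> carrier G" for g
      using surj that by (auto intro: inv_into_into)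
    fix g h assume "g \<in> carrier G" "h \<in> carrier G"
    then obtain a b where ab: "a \<in> carrier ?W" "b \<in> carrier ?W" "g = f a" "h = f b"
      using surj by blast
    then show "inv_into (carrier ?W) f (g \<otimes> h) =
        inv_into (carrier ?W) f g \<otimes>\<^bsub>?W\<^esub> inv_into (carrier ?W) f h"
      using inj W_closed by (simp flip: f_mult add: inv_into_f_f)
  qed
  then show ?thesis unfolding is_iso_def by blast
qed

end

section \<open>Elements of order p with a fixed point\<close>

context conj_closed_transversal
begin

definition Fix :: "'a \<Rightarrow> 'c set" where
  "Fix x = {\<alpha> \<in> Om. act x \<alpha> = \<alpha>}"

lemma Fix_int_pow: "x \<in> carrier G \<Longrightarrow> x [^] p = \<one> \<Longrightarrow> \<alpha> \<in> Fix x \<Longrightarrow> act (x [^] (i::int)) \<alpha> = \<alpha>"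
proof -
  assume *: "x \<in> carrier G" "x [^] p = \<one>" "\<alpha> \<in> Fix x"
  then interpret A: prime_cyclic_action p Om "\<lambda>i. act (x [^] i)" by (intro prime_action)
  show ?thesis using A.fixed_mult[of \<alpha> 1 i] * by (simp add: Fix_def)
qed

lemma commute_Fix:
  assumes "x \<in> carrier G" "g \<in> carrier G" "g \<otimes> x = x \<otimes> g" "\<alpha> \<in> Om"
  shows "act g \<alpha> \<in> Fix x \<longleftrightarrow> \<alpha> \<in> Fix x"
proof -
  have "act x (act g \<alpha>) = act g (act x \<alpha>)" using assms by (metis act_mult)
  then show ?thesis using assms by (simp add: Fix_def act_inj)
qed

lemma Fix_halves:
  assumes x: "x \<in> carrier G" "x [^] p = \<one>" "x \<noteq> \<one>" and ne: "Fix x \<noteq> {}"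
  shows "card (Fix x) = p" "card (Om - Fix x) = p"
    and "\<And>\<beta>. \<beta> \<in> Om \<Longrightarrow> \<beta> \<notin> Fix x \<Longrightarrow> Om - Fix x = orbit x \<beta>"
proof -
  interpret A: prime_cyclic_action p Om "\<lambda>i. act (x [^] i)" using x by (intro prime_action)
  obtain \<alpha> where \<alpha>: "\<alpha> \<in> Om" "act x \<alpha> = \<alpha>" using ne by (auto simp: Fix_def)
  have moved: "Om - Fix x = {\<beta> \<in> Om. act (x [^] (1::int)) \<beta> \<noteq> \<beta>}"
    using x by (auto simp: Fix_def)
  have orb: "Om - Fix x = A.orb \<beta>" if "\<beta> \<in> Om" "\<beta> \<notin> Fix x" for \<beta>
    unfolding moved using that \<alpha> x card_Om by (intro A.moved_eq_orb) (auto simp: Fix_def)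
  then show "\<And>\<beta>. \<beta> \<in> Om \<Longrightarrow> \<beta> \<notin> Fix x \<Longrightarrow> Om - Fix x = orbit x \<beta>"
    by (simp add: A.orb_def)
  have "\<exists>\<beta>\<in>Om. act x \<beta> \<noteq> \<beta>"
    using faithful[of x \<one>] x by auto
  then obtain \<beta> where \<beta>: "\<beta> \<in> Om" "\<beta> \<notin> Fix x" by (auto simp: Fix_def)
  then show c: "card (Om - Fix x) = p"
    using orb[OF \<beta>] A.card_orb[of \<beta>] x by (simp add: Fix_def)
  have "Fix x \<subseteq> Om" by (auto simp: Fix_def)
  then have "card Om = card (Fix x) + card (Om - Fix x)"
    using finite_Om by (metis card_Diff_subset card_mono finite_subset le_add_diff_inverse)
  then show "card (Fix x) = p" using c card_Om by simp
qed

text \<open>If \<gamma> and its image under t both lie in \<open>Fix x\<close>, then t and x t x^-1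
  are elements of \<open>T\<close> that agree at \<gamma>, hence are equal. So a t that does not
  commute with x maps \<open>Fix x\<close> into its complement, and both have p points.\<close>

lemma T_Fix:
  assumes x: "x \<in> carrier G" "x [^] p = \<one>" "x \<noteq> \<one>" and ne: "Fix x \<noteq> {}"
    and t: "t \<in> T" and \<alpha>: "\<alpha> \<in> Om"
  shows "act t \<alpha> \<in> Fix x \<longleftrightarrow> (\<alpha> \<in> Fix x \<longleftrightarrow> t \<otimes> x = x \<otimes> t)"
proof (cases "t \<otimes> x = x \<otimes> t")
  case True
  then show ?thesis using commute_Fix x t \<alpha> by simp
next
  case False
  have out: "act t \<gamma> \<in> Om - Fix x" if \<gamma>: "\<gamma> \<in> Fix x" for \<gamma>
  proof (rule ccontr)
    assume "act t \<gamma> \<notin> Om - Fix x"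
    then have t\<gamma>: "act t \<gamma> \<in> Fix x" using \<gamma> t by (simp add: Fix_def)
    have "act (inv x) \<gamma> = \<gamma>"
      using \<gamma> x act_inv[of x \<gamma>] by (simp add: Fix_def)
    then have "act (x \<otimes> t \<otimes> inv x) \<gamma> = act t \<gamma>"
      using x t \<gamma> t\<gamma> by (simp add: Fix_def)
    then have "x \<otimes> t \<otimes> inv x = t"
      using T_eqI[OF T_conj[OF x(1) t] t, of \<gamma>] \<gamma> by (simp add: Fix_def)
    then show False using False x t by (simp add: conj_eq_iff)
  qed
  have sub: "Fix x \<subseteq> Om" by (auto simp: Fix_def)
  have "card (act t ` Fix x) = p"
    using card_image[of "act t" "Fix x"] Fix_halves(1)[OF x ne] act_inj t sub
    by (auto simp: inj_on_def subset_iff)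
  then have eq: "act t ` Fix x = Om - Fix x"
    using out Fix_halves(2)[OF x ne] finite_Om by (intro card_subset_eq) auto
  show ?thesis
  proof
    assume "act t \<alpha> \<in> Fix x"
    then show "\<alpha> \<in> Fix x \<longleftrightarrow> t \<otimes> x = x \<otimes> t" using out False by blast
  next
    assume *: "\<alpha> \<in> Fix x \<longleftrightarrow> t \<otimes> x = x \<otimes> t"
    show "act t \<alpha> \<in> Fix x"
    proof (rule ccontr)
      assume "act t \<alpha> \<notin> Fix x"
      then have "act t \<alpha> \<in> act t ` Fix x" using eq t \<alpha> by simp
      then obtain \<gamma> where "\<gamma> \<in> Fix x" "act t \<alpha> = act t \<gamma>" by blast
      then show False using * False act_inj[of t \<alpha> \<gamma>] \<alpha> t sub by auto
    qed
  qed
qed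

text \<open>Take t in \<open>T\<close> moving a fixed point of x to a moved one, and y = t x t^-1.
  The supports of x and y are disjoint, so they commute. What needs work is that t also carries y
  back to x. The conjugate u = y t y^-1 lies in \<open>T\<close> and does not commute with x, so u =
  x^j t x^-j for some j. Evaluation at a point forces j = -1 modulo p, and y t y^-1 = x^-1 t x then
  simplifies to t y = x t.\<close>

lemma fixed_point_swap:
  assumes x: "x \<in> carrier G" "x [^] p = \<one>" "x \<noteq> \<one>" and ne: "Fix x \<noteq> {}"
  obtains t y where "t \<in> T" "t \<otimes> x \<noteq> x \<otimes> t" "y \<in> carrier G" "y [^] p = \<one>" "y \<noteq> \<one>"
    "Fix y = Om - Fix x" "x \<otimes> y = y \<otimes> x" "t \<otimes> x = y \<otimes> t" "t \<otimes> y = x \<otimes> t"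
proof -
  have sub: "Fix x \<subseteq> Om" for x by (auto simp: Fix_def)
  have "Om - Fix x \<noteq> {}"
    using Fix_halves(2)[OF x ne] p_ge3 card.empty by fastforce
  then obtain \<alpha> \<beta> where \<alpha>: "\<alpha> \<in> Fix x" and \<beta>: "\<beta> \<in> Om" "\<beta> \<notin> Fix x"
    using ne by blast
  then obtain t where t: "t \<in> T" "act t \<alpha> = \<beta>" using T_sharp[of \<alpha> \<beta>] sub by blast
  then have tx: "t \<otimes> x \<noteq> x \<otimes> t" using T_Fix[OF x ne t(1), of \<alpha>] \<alpha> \<beta> sub by auto
  have tF: "act t \<gamma> \<in> Fix x \<longleftrightarrow> \<gamma> \<notin> Fix x" if "\<gamma> \<in> Om" for \<gamma>
    using T_Fix[OF x ne t(1) that] tx by simp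
  define y where "y = t \<otimes> x \<otimes> inv t"
  have y: "y \<in> carrier G" using t x by (simp add: y_def)
  have ty: "t \<otimes> x = y \<otimes> t"
    using conj_eq_iff[of t x y] t x y by (simp add: y_def)
  have yp: "y [^] p = \<one>"
    using conj_int_pow[of t x "int p"] t x by (simp add: y_def int_pow_int)
  have y1: "y \<noteq> \<one>" using ty x t by auto
  have yt: "act y (act t \<gamma>) = act t (act x \<gamma>)" if "\<gamma> \<in> Om" for \<gamma>
    using that ty t x y by (metis T_carrier act_mult)
  have Fy: "\<gamma> \<in> Fix y \<longleftrightarrow> \<gamma> \<notin> Fix x" if \<gamma>: "\<gamma> \<in> Om" for \<gamma>
  proof -
    have 1: "act t (act (inv t) \<gamma>) = \<gamma>" "act (inv t) \<gamma> \<in> Om" using t \<gamma> by simp_all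
    have "\<gamma> \<in> Fix y \<longleftrightarrow> act (inv t) \<gamma> \<in> Fix x"
      using yt[OF 1(2)] 1 x t \<gamma> act_inj[of t "act x (act (inv t) \<gamma>)" "act (inv t) \<gamma>"]
      by (simp add: Fix_def)
    then show ?thesis using tF[OF 1(2)] 1 by simp
  qed
  then have FixY: "Fix y = Om - Fix x" using sub by blast
  have xF: "act x \<gamma> \<in> Fix x \<longleftrightarrow> \<gamma> \<in> Fix x" "act y \<gamma> \<in> Fix y \<longleftrightarrow> \<gamma> \<in> Fix y" if "\<gamma> \<in> Om" for \<gamma>
    using commute_Fix x y that by blast+
  have xy: "x \<otimes> y = y \<otimes> x"
  proof (rule faithful)
    fix \<gamma> assume \<gamma>: "\<gamma> \<in> Om"
    have "act x (act y \<gamma>) = act y (act x \<gamma>)"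
    proof (cases "\<gamma> \<in> Fix x")
      case True
      then have "act y \<gamma> \<in> Fix x" using xF(2)[OF \<gamma>] Fy[OF \<gamma>] Fy[of "act y \<gamma>"] \<gamma> y by simp
      then show ?thesis using True by (simp add: Fix_def)
    next
      case False
      then have "act x \<gamma> \<in> Fix y" "\<gamma> \<in> Fix y"
        using xF(1)[OF \<gamma>] Fy[OF \<gamma>] Fy[of "act x \<gamma>"] \<gamma> x by simp_all
      then show ?thesis by (simp add: Fix_def)
    qed
    then show "act (x \<otimes> y) \<gamma> = act (y \<otimes> x) \<gamma>" using x y \<gamma> by simp
  qed (use x y in simp_all)
  define u where "u = y \<otimes> t \<otimes> inv y"
  have u: "u \<in> T" using y t by (simp add: u_def T_conj)
  have uy: "u \<otimes> y = y \<otimes> t" using y t by (simp add: u_def m_assoc)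
  have ux: "u \<otimes> x \<noteq> x \<otimes> u"
  proof
    assume *: "u \<otimes> x = x \<otimes> u"
    have "y \<otimes> (t \<otimes> x) = u \<otimes> (y \<otimes> x)" using uy u x y t by (metis T_carrier m_assoc)
    also have "\<dots> = u \<otimes> x \<otimes> y" using u x y by (simp add: m_assoc xy)
    also have "\<dots> = x \<otimes> (y \<otimes> t)" unfolding * using u x y by (simp add: m_assoc uy)
    also have "\<dots> = y \<otimes> (x \<otimes> t)" using x y t by (simp add: xy flip: m_assoc)
    finally show False using tx x y t by simp
  qed
  then obtain j where j: "u = x [^] (j::int) \<otimes> t \<otimes> inv (x [^] j)"
    using T_noncommuting_orbit(1)[OF x(1,2) t(1) tx] u by blast
  have xyp: "x [^] j \<otimes> y = y \<otimes> x [^] j" using int_pow_commute[OF x(1) y xy] .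
  have txj: "t \<otimes> x [^] j = y [^] j \<otimes> t"
    using intertwine_int_pow[OF _ x(1) y ty] t by simp
  have uxj: "u \<otimes> x [^] j = x [^] j \<otimes> t" unfolding j using x t by (simp add: m_assoc)
  have key: "y [^] (j + 1) \<otimes> t = x [^] j \<otimes> t \<otimes> y"
  proof -
    have "y [^] (j + 1) \<otimes> t = y [^] (1 + j) \<otimes> t" by (simp add: add.commute)
    also have "\<dots> = y \<otimes> (y [^] j \<otimes> t)" using y t by (simp add: int_pow_mult m_assoc)
    also have "\<dots> = u \<otimes> y \<otimes> x [^] j" unfolding txj[symmetric] uy using x y t by (simp add: m_assoc)
    also have "\<dots> = u \<otimes> x [^] j \<otimes> y" using x y u by (simp add: m_assoc xyp)
    finally show ?thesis by (simp add: uxj)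
  qed
  \<comment> \<open>Evaluate \<open>key\<close> at \<beta>: y fixes \<beta> and x fixes its image
    under t. So y^(j+1) fixes that image, which y itself moves.\<close>
  have dvd: "int p dvd j + 1"
  proof -
    interpret B: prime_cyclic_action p Om "\<lambda>i. act (y [^] i)" using y yp by (intro prime_action)
    have \<beta>y: "act y \<beta> = \<beta>" using Fy[OF \<beta>(1)] \<beta> by (simp add: Fix_def)
    have "act (y [^] (j + 1)) (act t \<beta>) = act (x [^] j) (act t \<beta>)"
    proof -
      have "act (y [^] (j + 1) \<otimes> t) \<beta> = act (x [^] j \<otimes> t \<otimes> y) \<beta>" by (simp only: key)
      then show ?thesis using \<beta> \<beta>y x y t by simp
    qed
    moreover have t\<beta>: "act t \<beta> \<in> Fix x" using tF \<beta> by simp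
    ultimately have "act (y [^] (j + 1)) (act t \<beta>) = act (y [^] (0::int)) (act t \<beta>)"
      using Fix_int_pow[OF x(1,2)] \<beta> t by simp
    moreover have "act (y [^] (1::int)) (act t \<beta>) \<noteq> act t \<beta>"
      using Fy[of "act t \<beta>"] t\<beta> y \<beta> t by (auto simp: Fix_def)
    ultimately show ?thesis
      using B.eq_iff_dvd[of "act t \<beta>" "j + 1" 0] \<beta> t by simp
  qed
  then have y1: "y [^] (j + 1) = \<one>" and "x [^] (j + 1) = \<one>"
    using int_pow_mod_period[of y p "j + 1"] int_pow_mod_period[of x p "j + 1"] x y yp by simp_all
  then have "x \<otimes> x [^] j = \<one>"
    using x by (metis add.commute int_pow_1 int_pow_mult)
  then have "x \<otimes> (x [^] j \<otimes> t \<otimes> y) = t \<otimes> y"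
    using x y t by (simp add: m_assoc[symmetric])
  then have "t \<otimes> y = x \<otimes> t"
    unfolding key[symmetric] y1 using t by simp
  then show ?thesis using that[of t y] t tx y yp y1 FixY xy ty \<open>y \<noteq> \<one>\<close> by blast
qed

text \<open>Every element of G centralizes or exchanges the pair x, y, and the elements centralizing
  both are exactly the products of powers of x and y. It remains to replace t, which exchanges x and
  y, by an involution.\<close>

lemma fixed_point_case:
  assumes x: "x \<in> carrier G" "x [^] p = \<one>" "x \<noteq> \<one>" and ne: "Fix x \<noteq> {}"
  shows "G \<cong> wreath_Cp_C2 p" "\<And>g. g \<in> carrier G \<Longrightarrow> permutes_halves (Fix x) g"
proof -
  show "permutes_halves (Fix x) g" if "g \<in> carrier G" for g
  proof (rule permutes_halves_all[OF _ that])
    fix t assume "t \<in> T"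
    then show "permutes_halves (Fix x) t"
      unfolding permutes_halves_def using T_Fix[OF x ne] by (intro exI[of _ "t \<otimes> x = x \<otimes> t"]) blast
  qed
  obtain t y where t: "t \<in> T" "t \<otimes> x \<noteq> x \<otimes> t" and y: "y \<in> carrier G" "y [^] p = \<one>" "y \<noteq> \<one>"
    and Fy: "Fix y = Om - Fix x" and xy: "x \<otimes> y = y \<otimes> x"
    and tx: "t \<otimes> x = y \<otimes> t" and ty: "t \<otimes> y = x \<otimes> t"
    using fixed_point_swap[OF x ne] .
  have tc: "t \<in> carrier G" using t by simp
  have sub: "Fix x \<subseteq> Om" for x by (auto simp: Fix_def)
  have fixy: "Fix y \<noteq> {}" unfolding Fy using Fix_halves(2)[OF x ne] p_ge3 by (metis card.empty not_numeral_le_zero)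
  interpret A: prime_cyclic_action p Om "\<lambda>i. act (x [^] i)" using x by (intro prime_action)
  interpret B: prime_cyclic_action p Om "\<lambda>i. act (y [^] i)" using y by (intro prime_action)
  obtain \<alpha> \<beta> where \<alpha>: "\<alpha> \<in> Fix x" and \<beta>: "\<beta> \<in> Fix y" using ne fixy by blast
  then have \<alpha>\<beta>: "\<alpha> \<in> Om" "\<alpha> \<notin> Fix y" "\<beta> \<in> Om" "\<beta> \<notin> Fix x" using Fy sub by auto
  have xpow_fix: "act (x [^] i) \<gamma> = \<gamma>" if "\<gamma> \<in> Fix x" for \<gamma> and i :: int
    using Fix_int_pow[OF x(1,2) that] .
  have ypow_fix: "act (y [^] i) \<gamma> = \<gamma>" if "\<gamma> \<in> Fix y" for \<gamma> and i :: int
    using Fix_int_pow[OF y(1,2) that] .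
  have xdvd: "int p dvd i" if "act (x [^] i) \<beta> = \<beta>" for i
    using A.eq_iff_dvd[of \<beta> i 0] that x \<alpha>\<beta> by (simp add: Fix_def)
  have ydvd: "int p dvd i" if "act (y [^] i) \<alpha> = \<alpha>" for i
    using B.eq_iff_dvd[of \<alpha> i 0] that y \<alpha>\<beta> by (simp add: Fix_def)
  have xyp: "x [^] i \<otimes> y [^] j = y [^] j \<otimes> x [^] i" for i j :: int
    using int_pow_commute[OF y(1) x(1) xy[symmetric], of j]
    by (intro int_pow_commute) (use x y in simp_all)
  have tx': "t \<otimes> x [^] i = y [^] i \<otimes> t" and ty': "t \<otimes> y [^] i = x [^] i \<otimes> t" for i :: int
    using intertwine_int_pow tc x(1) y(1) tx ty by auto
  \<comment> \<open>On the support of x, a single orbit of <x>, an element that commutes with x acts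
    as the power of x that agrees with it at \<beta>; likewise for y and \<alpha>.\<close>
  have centralizer: "\<exists>i k. g = x [^] (i::int) \<otimes> y [^] (k::int)"
    if g: "g \<in> carrier G" "g \<otimes> x = x \<otimes> g" "g \<otimes> y = y \<otimes> g" for g
  proof -
    have "act g \<beta> \<in> orbit x \<beta>" "act g \<alpha> \<in> orbit y \<alpha>"
      using commute_Fix[OF x(1) g(1,2)] commute_Fix[OF y(1) g(1,3)] \<alpha>\<beta> g
        Fix_halves(3)[OF x ne, of \<beta>] Fix_halves(3)[OF y fixy, of \<alpha>] by auto
    then obtain i k where ik: "act g \<beta> = act (x [^] (i::int)) \<beta>" "act g \<alpha> = act (y [^] (k::int)) \<alpha>"
      by blast
    have gx: "x [^] l \<otimes> g = g \<otimes> x [^] l" and gy: "y [^] l \<otimes> g = g \<otimes> y [^] l" for l :: int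
      using g x y by (auto intro: int_pow_commute)
    have "g = x [^] i \<otimes> y [^] k"
    proof (rule faithful)
      fix \<delta> assume \<delta>: "\<delta> \<in> Om"
      show "act g \<delta> = act (x [^] i \<otimes> y [^] k) \<delta>"
      proof (cases "\<delta> \<in> Fix x")
        case False
        then obtain l where l: "\<delta> = act (x [^] (l::int)) \<beta>"
          using Fix_halves(3)[OF x ne, of \<beta>] \<alpha>\<beta> \<delta> by auto
        have "act g \<delta> = act (x [^] l \<otimes> g) \<beta>" using l x g \<alpha>\<beta> by (simp add: gx)
        also have "\<dots> = act (x [^] (i + l)) \<beta>" using x g ik \<alpha>\<beta> by (simp add: int_pow_mult add.commute[of i])
        also have "\<dots> = act (x [^] i) \<delta>" using l x \<alpha>\<beta> by (simp add: int_pow_mult)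
        also have "\<dots> = act (x [^] i \<otimes> y [^] k) \<delta>"
          using ypow_fix[of \<delta> k] False Fy \<delta> x y by simp
        finally show ?thesis .
      next
        case True
        then obtain l where l: "\<delta> = act (y [^] (l::int)) \<alpha>"
          using Fix_halves(3)[OF y fixy, of \<alpha>] \<alpha>\<beta> \<delta> Fy by auto
        have "act g \<delta> = act (y [^] l \<otimes> g) \<alpha>" using l y g \<alpha>\<beta> by (simp add: gy)
        also have "\<dots> = act (y [^] (k + l)) \<alpha>" using y g ik \<alpha>\<beta> by (simp add: int_pow_mult add.commute[of k])
        also have "\<dots> = act (y [^] k) \<delta>" using l y \<alpha>\<beta> by (simp add: int_pow_mult)
        also have "\<dots> = act (y [^] k \<otimes> x [^] i) \<delta>"
          using xpow_fix[of \<delta> i] True \<delta> x y by simp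
        finally show ?thesis by (simp add: xyp)
      qed
    qed (use g x y in simp_all)
    then show ?thesis by blast
  qed
  have tt: "t \<otimes> t \<otimes> x = x \<otimes> (t \<otimes> t)" "t \<otimes> t \<otimes> y = y \<otimes> (t \<otimes> t)"
    using tc x y by (metis m_assoc tx ty)+
  then obtain i k where ik: "t \<otimes> t = x [^] (i::int) \<otimes> y [^] (k::int)"
    using centralizer[of "t \<otimes> t"] tc by auto
  \<comment> \<open>Since t commutes with its own square and exchanges x and y, x^i y^k = x^k y^i.
    Evaluation at \<beta>, which y fixes, compares i and k.\<close>
  have "act (x [^] (k - i)) \<beta> = \<beta>"
  proof -
    have "x [^] k \<otimes> y [^] i \<otimes> t = x [^] i \<otimes> y [^] k \<otimes> t"
    proof -
      have "t \<otimes> (x [^] i \<otimes> y [^] k) = y [^] i \<otimes> (t \<otimes> y [^] k)"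
        using x y tc by (simp add: m_assoc[symmetric] tx')
      also have "\<dots> = x [^] k \<otimes> y [^] i \<otimes> t"
        unfolding ty' using x y tc by (simp add: m_assoc[symmetric] xyp)
      finally show ?thesis unfolding ik[symmetric] using tc by (simp add: m_assoc)
    qed
    then have "x [^] k \<otimes> y [^] i = x [^] i \<otimes> y [^] k"
      using x y tc by simp
    then have "act (x [^] k \<otimes> y [^] i) \<beta> = act (x [^] i \<otimes> y [^] k) \<beta>" by simp
    then have "act (x [^] k) \<beta> = act (x [^] i) \<beta>"
      using x y \<alpha>\<beta> ypow_fix[OF \<beta>] by simp
    then show ?thesis
      using A.eq_iff_dvd[of \<beta> k i] A.eq_iff_dvd[of \<beta> "k - i" 0] x \<alpha>\<beta> by (simp add: Fix_def)
  qed
  then have "x [^] i = x [^] k"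
    using xdvd[of "k - i"] int_pow_mod_period[OF x(1,2)] by (metis mod_eq_dvd_iff)
  then have tk: "t \<otimes> t = x [^] k \<otimes> y [^] k" using ik by simp
  \<comment> \<open>With t^2 = x^k y^k, the factor x^-k corrects the square: x^-k t = t y^-k gives
    s^2 = t^2 y^-k x^-k = 1.\<close>
  define s where "s = t \<otimes> x [^] (- k)"
  have s: "s \<in> carrier G" using tc x by (simp add: s_def)
  have ss: "s \<otimes> s = \<one>"
  proof -
    have "s \<otimes> s = t \<otimes> (x [^] (- k) \<otimes> t) \<otimes> x [^] (- k)" using tc x by (simp add: s_def m_assoc)
    also have "\<dots> = t \<otimes> t \<otimes> (y [^] (- k) \<otimes> x [^] (- k))"
      unfolding ty'[symmetric] using tc x y by (simp add: m_assoc)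
    also have "\<dots> = (x [^] k \<otimes> y [^] k) \<otimes> (y [^] (- k) \<otimes> x [^] (- k))" by (simp only: tk)
    also have "\<dots> = x [^] k \<otimes> (y [^] k \<otimes> y [^] (- k)) \<otimes> x [^] (- k)"
      using x y by (simp only: m_assoc m_closed int_pow_closed)
    also have "\<dots> = \<one>" using x y by (simp flip: int_pow_mult)
    finally show ?thesis .
  qed
  have sx: "s \<otimes> x = y \<otimes> s"
  proof -
    have "s \<otimes> x = t \<otimes> (x [^] (- k) \<otimes> x)" using tc x by (simp add: s_def m_assoc)
    also have "\<dots> = t \<otimes> x \<otimes> x [^] (- k)"
      using int_pow_commute[of x x "- k"] tc x by (simp add: m_assoc)
    finally show ?thesis unfolding tx using tc x y by (simp add: s_def m_assoc)
  qed
  have sy: "s \<otimes> y = x \<otimes> s"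
  proof -
    have "s \<otimes> y = t \<otimes> (x [^] (- k) \<otimes> y)" using tc x y by (simp add: s_def m_assoc)
    also have "\<dots> = t \<otimes> y \<otimes> x [^] (- k)"
      using int_pow_commute[OF x(1) y(1) xy, of "- k"] tc x y by (simp add: m_assoc)
    finally show ?thesis unfolding ty using tc x y by (simp add: s_def m_assoc)
  qed
  show "G \<cong> wreath_Cp_C2 p"
  proof (rule iso_wreath_Cp_C2[OF _ x(1,2) y(1,2) s ss xy sx sy])
    show "0 < p" using p_ge3 by simp
  next
    fix i j :: int assume *: "x [^] i \<otimes> y [^] j = \<one>"
    have "act (x [^] i \<otimes> y [^] j) \<beta> = \<beta>" "act (y [^] j \<otimes> x [^] i) \<alpha> = \<alpha>"
      using * \<alpha>\<beta> by (simp_all add: xyp)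
    then show "int p dvd i \<and> int p dvd j"
      using xdvd ydvd xpow_fix[OF \<alpha>] ypow_fix[OF \<beta>] x y \<alpha>\<beta> by simp
  next
    fix i j :: int
    show "s \<noteq> x [^] i \<otimes> y [^] j"
    proof
      assume "s = x [^] i \<otimes> y [^] j"
      then have "s \<otimes> x = x \<otimes> s"
        using int_pow_commute[OF x(1) x(1), of i] int_pow_commute[OF y(1) x(1) xy[symmetric], of j] x y
        by (metis int_pow_closed m_assoc)
      then have "x = y" using sx s x y by simp
      then show False using Fy \<alpha> by auto
    qed
  next
    fix g assume g: "g \<in> carrier G"
    \<comment> \<open>The stabilizer of the pair x, y under conjugation. It contains
      \<open>T\<close>: an element of \<open>T\<close> commuting with x preserves both supports and
      hence commutes with y, and every other one is conjugate to t by a power of x.\<close>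
    define W where "W = {g \<in> carrier G. g \<otimes> x = x \<otimes> g \<and> g \<otimes> y = y \<otimes> g \<or> g \<otimes> x = y \<otimes> g \<and> g \<otimes> y = x \<otimes> g}"
    have "subgroup W G"
    proof (rule subgroupI)
      have "\<one> \<in> W" using x y by (simp add: W_def)
      then show "W \<noteq> {}" by blast
    next
      fix a assume a: "a \<in> W"
      then show "inv a \<in> W"
        using intertwine_inv[of a x x] intertwine_inv[of a y y] intertwine_inv[of a x y]
          intertwine_inv[of a y x] x(1) y(1) unfolding W_def by blast
    next
      fix a b assume "a \<in> W" "b \<in> W"
      then show "a \<otimes> b \<in> W"
        using intertwine_mult[of a b] x(1) y(1) unfolding W_def by blast
    qed (simp add: W_def)
    moreover have "T \<subseteq> W"
    proof
      fix u assume u: "u \<in> T"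
      show "u \<in> W"
      proof (cases "u \<otimes> x = x \<otimes> u")
        case True
        then have "act u \<beta> \<notin> Fix x" using T_Fix[OF x ne u] \<alpha>\<beta> by simp
        then have "act u \<beta> \<in> Fix y" using Fy \<alpha>\<beta> u by simp
        then have "u \<otimes> y = y \<otimes> u" using T_Fix[OF y fixy u] \<alpha>\<beta> \<beta> by simp
        then show ?thesis using True u by (simp add: W_def)
      next
        case False
        then obtain i where i: "u = x [^] (i::int) \<otimes> t \<otimes> inv (x [^] i)"
          using T_noncommuting_orbit(1)[OF x(1,2) t] u by blast
        have c: "x [^] i \<otimes> z = z \<otimes> x [^] i" "inv (x [^] i) \<otimes> z = z \<otimes> inv (x [^] i)"
          if "z = x \<or> z = y" for z
          using int_pow_commute[of x z] that x y xy by (auto intro: intertwine_inv)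
        have "u \<otimes> x = y \<otimes> u" "u \<otimes> y = x \<otimes> u"
          unfolding i using x y tc c tx ty
          by (intro intertwine_mult[of _ _ x x y] intertwine_mult[of _ _ y y x] intertwine_mult[of _ _ x y y]
              intertwine_mult[of _ _ y x x]; simp)+
        then show ?thesis using u by (simp add: W_def)
      qed
    qed
    ultimately have W: "g \<in> W" using subgroup_of_T g by blast
    show "\<exists>i j. g = x [^] (i::int) \<otimes> y [^] (j::int) \<or> g = x [^] i \<otimes> y [^] j \<otimes> s"
    proof (cases "g \<otimes> x = x \<otimes> g \<and> g \<otimes> y = y \<otimes> g")
      case True
      then show ?thesis using centralizer[OF g] by blast
    next
      case False
      then have "g \<otimes> x = y \<otimes> g" "g \<otimes> y = x \<otimes> g" using W by (auto simp: W_def)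
      then have "g \<otimes> s \<otimes> x = x \<otimes> (g \<otimes> s)" "g \<otimes> s \<otimes> y = y \<otimes> (g \<otimes> s)"
        using intertwine_mult[OF g s x(1) y(1) x(1) sx] intertwine_mult[OF g s y(1) x(1) y(1) sy] by auto
      then obtain i k where "g \<otimes> s = x [^] (i::int) \<otimes> y [^] (k::int)"
        using centralizer[of "g \<otimes> s"] g s by auto
      then have "g = x [^] i \<otimes> y [^] k \<otimes> s"
        using g s ss by (metis m_assoc r_one)
      then show ?thesis by blast
    qed
  qed
qed

end

section \<open>Elements of order p without fixed points\<close>

text \<open>The last hypothesis speaks of all elements of order p and not just of x, so that the
  locale can be instantiated again at another such element; \<open>prime_order_unique\<close> does
  this twice.\<close>

locale fixed_point_free_element = conj_closed_transversal +
  fixes x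
  assumes x_carrier [simp]: "x \<in> carrier G" and x_pow: "x [^] p = \<one>" and x_neq_one: "x \<noteq> \<one>"
    and fixed_point_free: "y \<in> carrier G \<Longrightarrow> y [^] p = \<one> \<Longrightarrow> y \<noteq> \<one> \<Longrightarrow> Fix y = {}"
begin

sublocale A: prime_cyclic_action p Om "\<lambda>i. act (x [^] i)"
  using x_carrier x_pow by (rule prime_action)

lemma moved: "\<alpha> \<in> Om \<Longrightarrow> act (x [^] (1::int)) \<alpha> \<noteq> \<alpha>"
  using fixed_point_free[of x] x_pow x_neq_one by (auto simp: Fix_def)

lemma Om_nonempty: "\<exists>\<alpha>. \<alpha> \<in> Om"
  using card_Om p_ge3 by (metis card.empty ex_in_conv mult_eq_0_iff not_numeral_le_zero zero_neq_numeral)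

lemma x_int_pow_eq: "x [^] (i::int) = x [^] j \<longleftrightarrow> int p dvd (i - j)"
proof -
  obtain \<alpha> where \<alpha>: "\<alpha> \<in> Om" using Om_nonempty by blast
  have "x [^] i = x [^] j" if "int p dvd (i - j)"
    using that int_pow_mod_period[OF x_carrier x_pow] by (metis mod_eq_dvd_iff)
  then show ?thesis using A.eq_iff_dvd[OF \<alpha> moved[OF \<alpha>]] by metis
qed

lemma x_int_pow_eq_one: "x [^] (i::int) = \<one> \<longleftrightarrow> int p dvd i"
  using x_int_pow_eq[of i 0] by simp

lemma dvd_double: "int p dvd 2 * i \<longleftrightarrow> int p dvd i"
proof
  assume "int p dvd 2 * i"
  moreover have "\<not> int p dvd 2" using p_ge3 zdvd_imp_le by fastforce
  ultimately show "int p dvd i"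
    using prime_p prime_dvd_multD[of "int p" 2 i] by simp
qed simp

lemma x_int_pow_root:
  assumes "\<not> int p dvd i"
  obtains k where "x = (x [^] i) [^] (k::int)"
proof -
  have "coprime i (int p)"
    using assms prime_p by (metis prime_imp_coprime_int prime_nat_int_transfer coprime_commute)
  then obtain a b where ab: "a * i + b * int p = 1"
    by (metis bezout_int coprime_imp_gcd_eq_1)
  then have "i * a - 1 = int p * (- b)" by (simp add: algebra_simps)
  then have "x [^] (i * a) = x [^] (1::int)"
    unfolding x_int_pow_eq by simp
  then show ?thesis using that[of a] by (simp add: int_pow_pow)
qed

lemma commute_int_pow: "g \<in> carrier G \<Longrightarrow> g \<otimes> x = x \<otimes> g \<Longrightarrow> g \<otimes> x [^] (i::int) = x [^] i \<otimes> g"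
  using int_pow_commute[of x g i] by simp

lemma commute_x_of_commute_pow:
  assumes "g \<in> carrier G" "g \<otimes> x [^] (i::int) = x [^] i \<otimes> g" "\<not> int p dvd i"
  shows "g \<otimes> x = x \<otimes> g"
proof -
  obtain k where k: "x = (x [^] i) [^] (k::int)" using x_int_pow_root[OF assms(3)] .
  have "(x [^] i) [^] k \<otimes> g = g \<otimes> (x [^] i) [^] k"
    using assms by (intro int_pow_commute[of "x [^] i"]) (simp_all only: int_pow_closed x_carrier)
  then show ?thesis unfolding k[symmetric] by simp
qed

lemma commute_mult:
  "g \<in> carrier G \<Longrightarrow> h \<in> carrier G \<Longrightarrow> g \<otimes> x = x \<otimes> g \<Longrightarrow> h \<otimes> x = x \<otimes> h \<Longrightarrow> g \<otimes> h \<otimes> x = x \<otimes> (g \<otimes> h)"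
  by (rule intertwine_mult[of _ _ x x x]) simp_all

lemma commute_inv: "g \<in> carrier G \<Longrightarrow> g \<otimes> x = x \<otimes> g \<Longrightarrow> inv g \<otimes> x = x \<otimes> inv g"
  by (rule intertwine_inv) simp_all

lemma commute_nat_pow: "g \<in> carrier G \<Longrightarrow> g \<otimes> x = x \<otimes> g \<Longrightarrow> g [^] (n::nat) \<otimes> x = x \<otimes> g [^] n"
  using int_pow_commute[of g x "int n"] by (simp add: int_pow_int)

lemma pow_commute: "x [^] (i::int) \<otimes> x = x \<otimes> x [^] i"
  using int_pow_commute[of x x i] by simp

section \<open>The centralizer of an element of order p without fixed points\<close>

lemma two_orbits:
  assumes "\<alpha> \<in> Om" "\<beta> \<in> Om" "\<beta> \<notin> A.orb \<alpha>"
  shows "Om = A.orb \<alpha> \<union> A.orb \<beta>"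
  using A.two_orbs[OF card_Om] moved assms by blast

lemma exists_other_orbit:
  assumes "\<alpha> \<in> Om"
  obtains \<beta> where "\<beta> \<in> Om" "\<beta> \<notin> A.orb \<alpha>"
proof -
  have "card (A.orb \<alpha>) \<noteq> card Om"
    using A.card_orb[OF assms moved[OF assms]] card_Om p_ge3 by simp
  then have "A.orb \<alpha> \<noteq> Om" by auto
  then show ?thesis using A.orb_subset[OF assms] that by blast
qed

lemma fixes_both_orbits:
  assumes g: "g \<in> carrier G" "g \<otimes> x = x \<otimes> g"
    and \<alpha>: "\<alpha> \<in> Om" "act g \<alpha> = \<alpha>" and \<beta>: "\<beta> \<in> Om" "act g \<beta> = \<beta>" "\<beta> \<notin> A.orb \<alpha>"
  shows "g = \<one>"
proof (rule faithful)
  fix \<gamma> assume "\<gamma> \<in> Om"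
  then have "\<gamma> \<in> A.orb \<alpha> \<union> A.orb \<beta>" using two_orbits \<alpha> \<beta> by blast
  then obtain i \<delta> where \<delta>: "\<gamma> = act (x [^] (i::int)) \<delta>" "\<delta> \<in> Om" "act g \<delta> = \<delta>"
    using \<alpha> \<beta> by (auto simp: A.orb_def)
  have "act (g \<otimes> x [^] i) \<delta> = act (x [^] i \<otimes> g) \<delta>" by (simp only: commute_int_pow[OF g])
  then show "act g \<gamma> = act \<one> \<gamma>" using \<delta> g by simp
qed (use g in simp_all)

text \<open>The element g fixes the orbit of \<alpha> pointwise and preserves the other orbit, where
  it acts as some x^j. So g^p is trivial on both orbits, and g has a fixed point; by
  \<open>fixed_point_free\<close>, g is the identity.\<close>

lemma semiregular:
  assumes g: "g \<in> carrier G" "g \<otimes> x = x \<otimes> g" and \<alpha>: "\<alpha> \<in> Om" "act g \<alpha> = \<alpha>"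
  shows "g = \<one>"
proof -
  obtain \<beta> where \<beta>: "\<beta> \<in> Om" "\<beta> \<notin> A.orb \<alpha>" using exists_other_orbit \<alpha>(1) .
  have comm: "act g (act (x [^] i) \<gamma>) = act (x [^] i) (act g \<gamma>)" if "\<gamma> \<in> Om" for i :: int and \<gamma>
    using that g commute_int_pow[OF g, of i] by (metis act_mult int_pow_closed x_carrier)
  have "act g \<beta> \<notin> A.orb \<alpha>"
  proof
    assume "act g \<beta> \<in> A.orb \<alpha>"
    then obtain i where "act g \<beta> = act (x [^] (i::int)) \<alpha>" by (auto simp: A.orb_def)
    then have "act g \<beta> = act g (act (x [^] i) \<alpha>)" using comm \<alpha> by simp
    then have "\<beta> = act (x [^] i) \<alpha>" using g \<alpha> \<beta> by (simp add: act_inj)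
    then show False using \<beta> by (auto simp: A.orb_def)
  qed
  then have "act g \<beta> \<in> A.orb \<beta>" using two_orbits[OF \<alpha>(1) \<beta>] g \<beta> by (metis UnE act_closed)
  then obtain j where j: "act g \<beta> = act (x [^] (j::int)) \<beta>" by (auto simp: A.orb_def)
  have gn: "act (g [^] n) \<alpha> = \<alpha> \<and> act (g [^] n) \<beta> = act (x [^] (j * int n)) \<beta>" for n :: nat
  proof (induction n)
    case (Suc n)
    have "act (g [^] Suc n) \<beta> = act (g [^] n) (act (x [^] j) \<beta>)"
      using g \<beta> j by simp
    also have "\<dots> = act (x [^] j) (act (g [^] n) \<beta>)"
      using commute_int_pow[OF _ commute_nat_pow[OF g], of n j] g \<beta>
      by (metis act_mult int_pow_closed nat_pow_closed x_carrier)
    also have "\<dots> = act (x [^] (j * int (Suc n))) \<beta>"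
      using Suc \<beta> by (simp add: distrib_left A.add)
    finally show ?case using Suc g \<alpha> by simp
  qed (use \<alpha> \<beta> in simp)
  have "g [^] p = \<one>"
    using gn[of p] x_int_pow_eq_one[of "j * int p"] \<alpha> \<beta> g commute_nat_pow[OF g]
    by (intro fixes_both_orbits[of _ \<alpha> \<beta>]) simp_all
  then show ?thesis using fixed_point_free[of g] g \<alpha> by (auto simp: Fix_def)
qed

lemma centralizer_eqI:
  assumes g: "g \<in> carrier G" "g \<otimes> x = x \<otimes> g" and h: "h \<in> carrier G" "h \<otimes> x = x \<otimes> h"
    and \<alpha>: "\<alpha> \<in> Om" "act g \<alpha> = act h \<alpha>"
  shows "g = h"
proof -
  have "inv h \<otimes> g = \<one>"
    using assms by (intro semiregular[of _ \<alpha>] commute_mult commute_inv) simp_all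
  then show ?thesis using g h by (simp add: inv_solve_left')
qed

text \<open>By semiregularity an element of the centralizer of x is determined by the image of one
  point. Those that keep \<alpha> in its orbit are the powers of x, and the others form at most one
  further coset of <x>. In particular all squares lie in <x>.\<close>

lemma centralizer_in_orb:
  assumes c: "c \<in> carrier G" "c \<otimes> x = x \<otimes> c" and \<alpha>: "\<alpha> \<in> Om" "act c \<alpha> \<in> A.orb \<alpha>"
  shows "\<exists>i::int. c = x [^] i"
proof -
  obtain i where "act c \<alpha> = act (x [^] (i::int)) \<alpha>" using \<alpha> by (auto simp: A.orb_def)
  then show ?thesis
    using centralizer_eqI[OF c int_pow_closed[OF x_carrier] pow_commute \<alpha>(1)] by blast
qed

lemma centralizer_not_in_orb:
  assumes c: "c \<in> carrier G" "c \<otimes> x = x \<otimes> c" and d: "d \<in> carrier G" "d \<otimes> x = x \<otimes> d"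
    and \<alpha>: "\<alpha> \<in> Om" "act c \<alpha> \<notin> A.orb \<alpha>" "act d \<alpha> \<notin> A.orb \<alpha>"
  shows "\<exists>i::int. c = x [^] i \<otimes> d"
proof -
  have "act c \<alpha> \<in> A.orb (act d \<alpha>)"
    using two_orbits[of \<alpha> "act d \<alpha>"] c d \<alpha> by (metis UnE act_closed)
  then obtain i where "act c \<alpha> = act (x [^] (i::int) \<otimes> d) \<alpha>" using d \<alpha> by (auto simp: A.orb_def)
  moreover have "x [^] i \<otimes> d \<otimes> x = x \<otimes> (x [^] i \<otimes> d)"
    using commute_mult[OF _ d(1) pow_commute d(2)] by simp
  ultimately have "c = x [^] i \<otimes> d"
    using centralizer_eqI[OF c _ _ \<alpha>(1), of "x [^] i \<otimes> d"] d(1) by simp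
  then show ?thesis by blast
qed

lemma centralizer_square:
  assumes c: "c \<in> carrier G" "c \<otimes> x = x \<otimes> c"
  shows "\<exists>i::int. c \<otimes> c = x [^] i"
proof -
  obtain \<alpha> where \<alpha>: "\<alpha> \<in> Om" using Om_nonempty by blast
  show ?thesis
  proof (cases "act c \<alpha> \<in> A.orb \<alpha>")
    case True
    then obtain i where "c = x [^] (i::int)" using centralizer_in_orb c \<alpha> by blast
    then have "c \<otimes> c = x [^] (i + i)" by (simp only: int_pow_mult[OF x_carrier])
    then show ?thesis by blast
  next
    case False
    have "act (c \<otimes> c) \<alpha> \<in> A.orb \<alpha>"
    proof (rule ccontr)
      assume "act (c \<otimes> c) \<alpha> \<notin> A.orb \<alpha>"
      then obtain i where "c \<otimes> c = x [^] (i::int) \<otimes> c"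
        using centralizer_not_in_orb[of "c \<otimes> c" c \<alpha>] commute_mult[of c c] c \<alpha> False by auto
      then have "c = x [^] i" using c by simp
      then show False using False by (auto simp: A.orb_def)
    qed
    then show ?thesis using centralizer_in_orb[of "c \<otimes> c" \<alpha>] commute_mult[of c c] c \<alpha> by simp
  qed
qed

lemma no_involution_in_powers: "x [^] (i::int) \<otimes> x [^] i = \<one> \<Longrightarrow> x [^] i = \<one>"
proof -
  assume "x [^] i \<otimes> x [^] i = \<one>"
  then have "x [^] (i + i) = \<one>" by (simp only: int_pow_mult[OF x_carrier])
  then have "int p dvd 2 * i" unfolding x_int_pow_eq_one by simp
  then show ?thesis by (simp only: dvd_double x_int_pow_eq_one)
qed

lemma involution_not_in_orb:
  assumes s: "s \<in> carrier G" "s \<otimes> x = x \<otimes> s" "s \<otimes> s = \<one>" "s \<noteq> \<one>" and \<alpha>: "\<alpha> \<in> Om"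
  shows "act s \<alpha> \<notin> A.orb \<alpha>"
  using centralizer_in_orb[OF s(1,2) \<alpha>] no_involution_in_powers s(3,4) by blast

text \<open>Two involutions lie in the same coset of <x>, so s = x^i r, and squaring gives x^(2i) =
  1. As p is odd, x^i = 1.\<close>

lemma involution_unique:
  assumes s: "s \<in> carrier G" "s \<otimes> x = x \<otimes> s" "s \<otimes> s = \<one>" "s \<noteq> \<one>"
    and r: "r \<in> carrier G" "r \<otimes> x = x \<otimes> r" "r \<otimes> r = \<one>" "r \<noteq> \<one>"
  shows "s = r"
proof -
  obtain \<alpha> where \<alpha>: "\<alpha> \<in> Om" using Om_nonempty by blast
  obtain i where i: "s = x [^] (i::int) \<otimes> r"
    using centralizer_not_in_orb[OF s(1,2) r(1,2) \<alpha>] involution_not_in_orb[OF s \<alpha>] involution_not_in_orb[OF r \<alpha>]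
    by blast
  have "s \<otimes> s = x [^] i \<otimes> (r \<otimes> x [^] i) \<otimes> r" unfolding i using r by (simp add: m_assoc)
  also have "\<dots> = x [^] i \<otimes> x [^] i \<otimes> (r \<otimes> r)"
    unfolding commute_int_pow[OF r(1,2)] using r(1) by (simp only: m_assoc m_closed int_pow_closed x_carrier)
  finally have "x [^] i \<otimes> x [^] i = \<one>" using s r by simp
  then show ?thesis using no_involution_in_powers i r by simp
qed

text \<open>On a non-trivial \<open>\<langle>x\<rangle>\<close>-orbit in \<open>T\<close>, \<open>s\<close> acts as a translation of order at most 2 of \<open>\<int>/p\<close>.\<close>
lemma involution_central:
  assumes s: "s \<in> carrier G" "s \<otimes> x = x \<otimes> s" "s \<otimes> s = \<one>" and g: "g \<in> carrier G"
  shows "g \<otimes> s = s \<otimes> g"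
proof (cases "s = \<one>")
  case False
  have si: "inv s = s" using s by (simp add: inv_equality)
  show ?thesis
  proof (rule commute_all[OF s(1) _ g])
    fix t assume t: "t \<in> T"
    show "t \<otimes> s = s \<otimes> t"
    proof (cases "t \<otimes> x = x \<otimes> t")
      case True
      \<comment> \<open>Here t s t^-1 is again an involution centralizing x, so it is s by
        uniqueness.\<close>
      have "t \<otimes> s \<otimes> inv t = s"
      proof (rule involution_unique)
        have "(t \<otimes> s \<otimes> inv t) [^] (2::int) = t \<otimes> s [^] (2::int) \<otimes> inv t"
          using s t by (intro conj_int_pow) simp_all
        then show "t \<otimes> s \<otimes> inv t \<otimes> (t \<otimes> s \<otimes> inv t) = \<one>"
          using s t by (simp add: int_pow_def2 numeral_2_eq_2)
        show "t \<otimes> s \<otimes> inv t \<noteq> \<one>" using s t False by (simp add: conj_eq_iff)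
      qed (use s t True False in \<open>simp_all add: commute_mult commute_inv\<close>)
      then show ?thesis using s t by (simp add: conj_eq_iff)
    next
      case noncomm: False
      interpret C: prime_cyclic_action p T "\<lambda>i y. x [^] i \<otimes> y \<otimes> inv (x [^] i)"
        using x_pow by (intro prime_conj_action) (auto intro: T_conj)
      define u where "u = s \<otimes> t \<otimes> s"
      have u: "u \<in> T" using T_conj[OF s(1) t] si by (simp add: u_def)
      have sus: "s \<otimes> u \<otimes> s = t"
      proof -
        have "s \<otimes> u \<otimes> s = (s \<otimes> s) \<otimes> t \<otimes> (s \<otimes> s)" using s(1) t by (simp only: u_def m_assoc m_closed T_carrier)
        then show ?thesis using s t by simp
      qed
      have "u \<otimes> x \<noteq> x \<otimes> u"
      proof
        assume "u \<otimes> x = x \<otimes> u"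
        then have "s \<otimes> u \<otimes> s \<otimes> x = x \<otimes> (s \<otimes> u \<otimes> s)"
          using s u by (intro commute_mult) simp_all
        then show False using sus noncomm by simp
      qed
      then obtain i where i: "u = x [^] (i::int) \<otimes> t \<otimes> inv (x [^] i)"
        using T_noncommuting_orbit(1)[OF x_carrier x_pow t noncomm] u by blast
      have sx: "s \<otimes> x [^] i = x [^] i \<otimes> s" using commute_int_pow s by blast
      have sx': "inv (x [^] i) \<otimes> s = s \<otimes> inv (x [^] i)"
        using intertwine_inv[of "x [^] i" s s] s sx by simp
      have "t = (s \<otimes> x [^] i) \<otimes> t \<otimes> (inv (x [^] i) \<otimes> s)"
        using sus s t by (simp add: i m_assoc)
      also have "\<dots> = x [^] i \<otimes> (s \<otimes> t \<otimes> s) \<otimes> inv (x [^] i)"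
        unfolding sx sx' using s t by (simp add: m_assoc)
      finally have "x [^] (i + i) \<otimes> t \<otimes> inv (x [^] (i + i)) = t"
        using C.add[OF t, of i i] by (simp add: i flip: u_def)
      moreover have "x [^] (1::int) \<otimes> t \<otimes> inv (x [^] (1::int)) \<noteq> t"
        using noncomm t by (auto simp: conj_eq_iff)
      ultimately have "int p dvd 2 * i"
        using C.eq_iff_dvd[OF t, of "i + i" 0] t by simp
      then have "x [^] i = \<one>" by (simp only: dvd_double x_int_pow_eq_one)
      then have "s \<otimes> (t \<otimes> s) = t" using i s t by (simp add: u_def m_assoc)
      then have "s \<otimes> t = s \<otimes> s \<otimes> (t \<otimes> s)" using s(1) t by (simp only: m_assoc m_closed T_carrier)
      then show ?thesis using s t by simp
    qed
  qed
qed (use g in simp)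

text \<open>The automorphism group of C_p has order p - 1, so it has no element of order p.
  Concretely, a non-trivial <z>-orbit of x would have p members among the p - 1 non-trivial powers
  of x.\<close>

lemma normalizing_commutes:
  assumes z: "z \<in> carrier G" "z [^] p = \<one>" and l: "z \<otimes> x \<otimes> inv z = x [^] (l::int)"
  shows "z \<otimes> x = x \<otimes> z"
proof (rule ccontr)
  assume nc: "z \<otimes> x \<noteq> x \<otimes> z"
  define Y where "Y = carrier G"
  interpret C: prime_cyclic_action p Y "\<lambda>i y. z [^] i \<otimes> y \<otimes> inv (z [^] i)"
    using z unfolding Y_def by (intro prime_conj_action) auto
  have xY: "x \<in> Y" by (simp add: Y_def)
  have mv: "z [^] (1::int) \<otimes> x \<otimes> inv (z [^] (1::int)) \<noteq> x"
    using nc z by (simp add: conj_eq_iff)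
  have n: "\<exists>i::int. z [^] int n \<otimes> x \<otimes> inv (z [^] int n) = x [^] i" for n
  proof (induction n)
    case 0
    show ?case by (rule exI[of _ 1]) simp
  next
    case (Suc n)
    then obtain i where i: "z [^] int n \<otimes> x \<otimes> inv (z [^] int n) = x [^] (i::int)" by blast
    have "z [^] int (Suc n) \<otimes> x \<otimes> inv (z [^] int (Suc n))
        = z [^] (1::int) \<otimes> (z [^] int n \<otimes> x \<otimes> inv (z [^] int n)) \<otimes> inv (z [^] (1::int))"
      using C.add[OF xY, of 1 "int n"] by (simp only: of_nat_Suc)
    also have "\<dots> = z \<otimes> x [^] i \<otimes> inv z" unfolding i using z by simp
    also have "\<dots> = x [^] (l * i)"
      using conj_int_pow[OF z(1) x_carrier, of i] unfolding l by (simp add: int_pow_pow)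
    finally show ?case by blast
  qed
  have "C.orb x \<subseteq> (\<lambda>i. x [^] i) ` {1..<int p}"
  proof
    fix y assume "y \<in> C.orb x"
    then obtain k where k: "y = z [^] (k::int) \<otimes> x \<otimes> inv (z [^] k)" by (auto simp: C.orb_def)
    have "int (nat (k mod int p)) = k mod int p" using p_ge3 by simp
    then have k': "y = z [^] int (nat (k mod int p)) \<otimes> x \<otimes> inv (z [^] int (nat (k mod int p)))"
      unfolding k by (simp only: int_pow_mod_period[OF z])
    then obtain i where i: "y = x [^] (i::int)" using n by metis
    have "y \<noteq> \<one>" using k z x_neq_one by (simp add: conj_eq_iff)
    then have "i mod int p \<noteq> 0" unfolding i x_int_pow_eq_one by auto
    moreover have "0 \<le> i mod int p" "i mod int p < int p" using p_ge3 by simp_all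
    ultimately have "i mod int p \<in> {1..<int p}" by simp
    moreover have "y = x [^] (i mod int p)"
      unfolding i by (rule int_pow_mod_period[OF x_carrier x_pow, symmetric])
    ultimately show "y \<in> (\<lambda>i. x [^] i) ` {1..<int p}" by blast
  qed
  then have "card (C.orb x) \<le> card ((\<lambda>i. x [^] i) ` {1..<int p})"
    by (intro card_mono) auto
  also have "\<dots> \<le> card {1..<int p}" by (intro card_image_le) simp
  finally have "p \<le> card {1..<int p}" unfolding C.card_orb[OF xY mv] .
  then show False using p_ge3 by simp
qed

text \<open>The rest of \<open>T\<close> is one orbit under conjugation by \<open>x\<close>. Let \<open>u\<close> be the element of it with
  \<open>u e = x\<^sup>2 e\<close>: the images of \<open>e\<close> under the conjugates of \<open>u\<close> determine \<open>u\<close> on the other points, and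
  \<open>u\<close> is not injective.\<close>
lemma no_small_centralizer:
  assumes p3: "p = 3"
    and s: "s \<in> carrier G" "s \<otimes> x = x \<otimes> s" "s \<otimes> s = \<one>" "s \<noteq> \<one>"
    and t: "t = x \<or> t = x \<otimes> s"
    and T0: "{t \<in> T. t \<otimes> x = x \<otimes> t} = {\<one>, s, t}"
  shows False
proof -
  obtain e where e: "e \<in> Om" using Om_nonempty by blast
  have sx: "act s (act x \<alpha>) = act x (act s \<alpha>)" if "\<alpha> \<in> Om" for \<alpha>
    using that s by (metis act_mult x_carrier)
  have "x \<otimes> (x \<otimes> x) = \<one>"
    using x_pow unfolding p3 numeral_3_eq_3 by (simp add: m_assoc)
  then have xxx: "act x (act x (act x \<alpha>)) = \<alpha>" if "\<alpha> \<in> Om" for \<alpha>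
    using that act_mult[of x "x \<otimes> x" \<alpha>] by simp
  have ss: "act s (act s \<alpha>) = \<alpha>" if "\<alpha> \<in> Om" for \<alpha>
    using s that by (metis act_mult act_one)
  have orb: "act x (act x e) \<in> A.orb e" "act x e \<in> A.orb e" "e \<in> A.orb e"
    using A.orb_closed[OF e, of _ 1] A.self_in_orb[OF e] by simp_all
  have sorb: "act s e \<notin> A.orb e" "act s (act x e) \<notin> A.orb e" "act s (act x (act x e)) \<notin> A.orb e"
  proof -
    show 1: "act s e \<notin> A.orb e" by (rule involution_not_in_orb[OF s e])
    have "act s \<gamma> \<notin> A.orb e" if "\<gamma> \<in> A.orb e" for \<gamma>
    proof
      assume "act s \<gamma> \<in> A.orb e"
      then obtain i where "act s \<gamma> = act (x [^] (i::int)) e" by (auto simp: A.orb_def)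
      moreover have \<gamma>: "\<gamma> \<in> Om" using A.orb_subset[OF e] that by blast
      ultimately have "act s \<gamma> \<in> A.orb \<gamma>"
        using A.orb_closed[OF \<gamma> A.orb_sym[OF e that], of i] by simp
      then show False using involution_not_in_orb[OF s \<gamma>] by blast
    qed
    then show "act s (act x e) \<notin> A.orb e" "act s (act x (act x e)) \<notin> A.orb e" using orb by blast+
  qed
  have ne: "act x \<alpha> \<noteq> \<alpha>" if "\<alpha> \<in> Om" for \<alpha> using moved[OF that] by simp
  have te: "act t e = act x e \<or> act t e = act s (act x e)" using t s e sx by auto
  have noncomm: "u \<otimes> x \<noteq> x \<otimes> u"
    if u: "u \<in> T" "act u e \<noteq> e" "act u e \<noteq> act s e" "act u e \<noteq> act t e" for u
  proof
    assume "u \<otimes> x = x \<otimes> u"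
    then have "u \<in> {\<one>, s, t}" using u unfolding T0[symmetric] by blast
    then show False using u e by auto
  qed
  have Om6: "act x e \<in> Om" "act x (act x e) \<in> Om" "act s e \<in> Om" "act s (act x e) \<in> Om"
     "act s (act x (act x e)) \<in> Om" "act t e \<in> Om" "act s (act t e) \<in> Om"
    using e s te by auto
  \<comment> \<open>The six points are x^i e and s x^i e. The elements 1, s, t of \<open>T\<close>
    send e to e, s e and one of x e, s x e; u, w and v are the elements that send e to the three
    remaining points.\<close>
  obtain u where u: "u \<in> T" "act u e = act x (act x e)" using T_sharp[OF e, of "act x (act x e)"] Om6 by auto
  obtain w where w: "w \<in> T" "act w e = act s (act x (act x e))"
    using T_sharp[OF e, of "act s (act x (act x e))"] Om6 by auto
  obtain v where v: "v \<in> T" "act v e = act s (act t e)"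
    using T_sharp[OF e, of "act s (act t e)"] Om6 by auto
  let ?a1 = "act x e" and ?a2 = "act x (act x e)"
  have a2: "?a2 \<noteq> e" "?a2 \<noteq> ?a1" "?a1 \<noteq> e" using xxx[OF e] ne e by (metis act_closed x_carrier)+
  have b: "\<alpha> \<noteq> act s \<beta>" if "\<alpha> \<in> {e, ?a1, ?a2}" "\<beta> \<in> {e, ?a1, ?a2}" for \<alpha> \<beta>
    using that orb sorb by auto
  have sinj: "act s \<alpha> \<noteq> act s \<beta>" if "\<alpha> \<in> {e, ?a1, ?a2}" "\<beta> \<in> {e, ?a1, ?a2}" "\<alpha> \<noteq> \<beta>" for \<alpha> \<beta>
    using that act_inj[OF s(1)] e Om6 by auto
  have ste: "act s (act t e) = act s ?a1 \<or> act s (act t e) = ?a1"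
    using te ss[OF Om6(1)] by auto
  have ste': "act s (act t e) \<noteq> act t e"
    using te ss[OF Om6(1)] b[of ?a1 ?a1] by auto
  have nu: "u \<otimes> x \<noteq> x \<otimes> u"
    using noncomm[OF u(1)] u(2) a2 b[of ?a2 e] b[of ?a2 ?a1] te by auto
  have nw: "w \<otimes> x \<noteq> x \<otimes> w"
    using noncomm[OF w(1)] w(2) a2 b[of e ?a2] b[of ?a1 ?a2] sinj[of ?a2 e] sinj[of ?a2 ?a1] te by auto
  have nv: "v \<otimes> x \<noteq> x \<otimes> v"
    using noncomm[OF v(1)] v(2) a2 b[of e ?a1] b[of ?a1 e] sinj[of ?a1 e] ste ste' by auto
  have su: "act u (act s \<alpha>) = act s (act u \<alpha>)" if "\<alpha> \<in> Om" for \<alpha>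
    using involution_central[OF s(1-3), of u] u(1) s(1) that by (metis T_carrier act_mult)
  \<comment> \<open>Write w = x^k u x^-k and evaluate u x^-k = x^-k w at e. For -k = 1 or 2 modulo 3
    this gives the image under u of x e or x^2 e; for -k = 0 it would give w = u.\<close>
  have shift: "act u ?a1 = act x (act w e) \<or> act u ?a2 = act x (act x (act w e))"
    if w: "w \<in> T" "w \<otimes> x \<noteq> x \<otimes> w" "act w e \<noteq> act u e" for w
  proof -
    obtain k where k: "w = x [^] (k::int) \<otimes> u \<otimes> inv (x [^] k)"
      using T_noncommuting_orbit(1)[OF x_carrier x_pow u(1) nu] w by blast
    have uk: "u \<otimes> x [^] (- k) = x [^] (- k) \<otimes> w"
      unfolding k using u by (simp add: int_pow_neg m_assoc[symmetric])
    have mod: "x [^] (- k) = x [^] ((- k) mod 3)"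
      using int_pow_mod_period[OF x_carrier x_pow, of "- k"] by (simp add: p3)
    consider "(- k) mod 3 = 0" | "(- k) mod 3 = 1" | "(- k) mod 3 = 2" by linarith
    then show ?thesis
    proof cases
      case 1
      then have "w = u" using uk u w by (simp add: mod)
      then show ?thesis using w by simp
    next
      case 2
      then have "act (u \<otimes> x) e = act (x \<otimes> w) e" using uk by (simp add: mod)
      then show ?thesis using u w e by simp
    next
      case 3
      have "x [^] (2::int) = x \<otimes> x" by (simp add: int_pow_def2 numeral_2_eq_2)
      then have "act (u \<otimes> (x \<otimes> x)) e = act (x \<otimes> x \<otimes> w) e" using uk 3 by (simp add: mod)
      then show ?thesis using u w e by simp
    qed
  qed
  have w': "act u ?a1 = act s e \<or> act u ?a2 = act s ?a1"
    using shift[OF w(1) nw] w(2) u(2) b[of ?a2 ?a2] sx xxx e s(1) Om6 by simp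
  have v': "act u ?a1 = act s ?a2 \<or> act u ?a1 = ?a2 \<or> act u ?a2 = act s e \<or> act u ?a2 = e"
    using shift[OF v(1) nv] v(2) u(2) b[of ?a2 ?a1] a2 ste sx xxx e s(1) Om6 by auto
  have uinj: "act u \<alpha> = act u \<beta> \<longleftrightarrow> \<alpha> = \<beta>" if "\<alpha> \<in> Om" "\<beta> \<in> Om" for \<alpha> \<beta>
    using act_inj u that by simp
  have use: "act u (act s e) = act s ?a2" "act u (act s ?a1) = act s (act u ?a1)"
    using su e Om6 u by simp_all
  from w' show False
  proof
    assume 1: "act u ?a1 = act s e"
    then have "act u ?a2 = act s e \<or> act u ?a2 = e"
      using v' sinj[of e ?a2] b[of ?a2 e] a2 by auto
    then show False
    proof
      assume "act u ?a2 = act s e"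
      then show False using 1 uinj Om6 a2 by metis
    next
      assume "act u ?a2 = e"
      moreover have "act u (act s ?a1) = e" using use 1 ss[OF e] by simp
      ultimately show False using uinj Om6 b[of ?a2 ?a1] by (metis insertCI)
    qed
  next
    assume 1: "act u ?a2 = act s ?a1"
    then have "act u ?a1 = act s ?a2 \<or> act u ?a1 = ?a2"
      using v' sinj[of e ?a1] b[of e ?a1] a2 by auto
    then show False
    proof
      assume "act u ?a1 = act s ?a2"
      then have "?a1 = act s e" using use(1) uinj Om6 by metis
      then show False using b[of ?a1 e] by blast
    next
      assume "act u ?a1 = ?a2"
      then have "?a1 = e" using u(2) uinj Om6 e by metis
      then show False using a2 by blast
    qed
  qed
qed

text \<open>Otherwise the elements of \<open>T\<close> that centralize \<open>x\<close> but are not involutions form part of a single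
  \<open>\<langle>y\<rangle>\<close>-orbit, on which no two elements can both have their square in \<open>\<langle>x\<rangle>\<close>; as there are at least
  \<open>p - 2\<close> of them, \<open>p = 3\<close>.\<close>
lemma prime_order_unique:
  assumes y: "y \<in> carrier G" "y [^] p = \<one>"
  shows "\<exists>i::int. y = x [^] i"
proof (rule ccontr)
  assume not: "\<not> ?thesis"
  then have y1: "y \<noteq> \<one>" using x_int_pow_eq_one[of 0] by (metis int_pow_0)
  interpret Y: fixed_point_free_element G act Om T p y
    using y y1 fixed_point_free by unfold_locales
  have yx: "y \<otimes> x \<noteq> x \<otimes> y"
  proof
    assume "y \<otimes> x = x \<otimes> y"
    then obtain i where i: "y \<otimes> y = x [^] (i::int)" using centralizer_square y by blast
    have "y [^] (2::int) = y \<otimes> y" using y by (simp add: int_pow_def2 numeral_2_eq_2)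
    \<comment> \<open>With p + 1 = 2n, y is the n-th power of its square, and that square is a power
      of x.\<close>
    obtain n where n: "int p + 1 = 2 * n" using odd_p by (metis evenE even_plus_one_iff even_of_nat)
    have "y = y [^] (int p + 1)" using y by (simp add: int_pow_mult int_pow_int)
    also have "\<dots> = (y [^] (2::int)) [^] n" unfolding n using y by (simp only: int_pow_pow)
    also have "\<dots> = x [^] (i * n)" unfolding \<open>y [^] (2::int) = y \<otimes> y\<close> i by (simp add: int_pow_pow)
    finally show False using not by blast
  qed
  obtain u where u: "u \<in> T" "u \<otimes> x \<noteq> x \<otimes> u"
    using commute_all[OF x_carrier _ y(1)] yx by blast
  define T0 where "T0 = {t \<in> T. t \<otimes> x = x \<otimes> t}"
  have card_T0: "card T0 = p" unfolding T0_def by (rule T_noncommuting_orbit(3)[OF x_carrier x_pow u])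
  have finT0: "finite T0" using finite_T by (simp add: T0_def)
  have root_commute: "y [^] (k::int) \<otimes> x = x \<otimes> y [^] k \<Longrightarrow> int p dvd k" for k
  proof (rule ccontr)
    assume *: "y [^] k \<otimes> x = x \<otimes> y [^] k" "\<not> int p dvd k"
    then show False using Y.commute_x_of_commute_pow[of x k] yx by simp
  qed
  \<comment> \<open>An element whose square is a non-trivial power of x cannot commute with y, since
    y would then commute with x. So t and t' lie in one <y>-orbit, t' = z t z^-1 with z a power of
    y. Comparing squares, z normalizes <x>, hence centralizes x, and this leaves only z = 1.\<close>
  have unique: "t = t'" if t: "t \<in> T0" "t \<otimes> t \<noteq> \<one>" and t': "t' \<in> T0" "t' \<otimes> t' \<noteq> \<one>" for t t'
  proof -
    have square: "\<exists>i. r \<otimes> r = x [^] (i::int) \<and> \<not> int p dvd i" if r: "r \<in> T0" "r \<otimes> r \<noteq> \<one>" for r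
    proof -
      obtain i where "r \<otimes> r = x [^] (i::int)" using centralizer_square[of r] r by (auto simp: T0_def)
      then show ?thesis using r x_int_pow_eq_one by metis
    qed
    obtain i j where i: "t \<otimes> t = x [^] (i::int)" "\<not> int p dvd i" and j: "t' \<otimes> t' = x [^] (j::int)"
      using square[OF t] square[OF t'] by blast
    have nc: "r \<otimes> y \<noteq> y \<otimes> r" if r: "r \<in> T0" "r \<otimes> r \<noteq> \<one>" for r
    proof
      assume ry: "r \<otimes> y = y \<otimes> r"
      obtain i where i: "r \<otimes> r = x [^] (i::int)" "\<not> int p dvd i" using square[OF r] by blast
      have "r \<otimes> r \<otimes> y = y \<otimes> (r \<otimes> r)" using Y.commute_mult[of r r] ry r by (simp add: T0_def)
      then show False using commute_x_of_commute_pow[OF y(1), of i] i yx by simp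
    qed
    obtain k where k: "t' = y [^] (k::int) \<otimes> t \<otimes> inv (y [^] k)"
      using T_noncommuting_orbit(1)[OF y, of t] nc[OF t] nc[OF t'] t t' unfolding T0_def by blast
    have tc: "t \<in> carrier G" using t by (simp add: T0_def)
    define z where "z = y [^] k"
    have z: "z \<in> carrier G" "z [^] p = \<one>"
    proof -
      have "z [^] int p = (y [^] int p) [^] k" using y by (simp add: z_def int_pow_pow mult.commute)
      then show "z [^] p = \<one>" using y by (simp add: int_pow_int)
    qed (use y in \<open>simp add: z_def\<close>)
    have "t' \<otimes> t' = z \<otimes> t \<otimes> (inv z \<otimes> z) \<otimes> t \<otimes> inv z"
      unfolding k z_def[symmetric] using z(1) tc by (simp only: m_assoc m_closed inv_closed)
    also have "\<dots> = z \<otimes> (t \<otimes> t) \<otimes> inv z"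
      using z(1) tc by (simp add: m_assoc)
    finally have "z \<otimes> x [^] i \<otimes> inv z = x [^] j"
      unfolding i(1) j by (rule sym)
    moreover obtain l where l: "x = (x [^] i) [^] (l::int)" using x_int_pow_root[OF i(2)] .
    ultimately have "z \<otimes> x \<otimes> inv z = x [^] (j * l)"
      using conj_int_pow[OF z(1), of "x [^] i" l] by (simp add: int_pow_pow flip: l)
    then have "z \<otimes> x = x \<otimes> z" using normalizing_commutes z by blast
    then have "int p dvd k" using root_commute by (simp add: z_def)
    then have "z = \<one>" using Y.x_int_pow_eq_one by (simp add: z_def)
    then show ?thesis using k tc by (simp add: z_def)
  qed
  define N where "N = {t \<in> T0. t \<otimes> t \<noteq> \<one>}"
  define I where "I = {t \<in> T0. t \<otimes> t = \<one> \<and> t \<noteq> \<one>}"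
  have inv_unique: "s = r" if "s \<in> I" "r \<in> I" for s r
    using that involution_unique by (simp add: I_def T0_def)
  have cN: "card N \<le> Suc 0"
  proof -
    have "finite N" using finT0 by (simp add: N_def)
    moreover have "\<forall>t\<in>N. \<forall>t'\<in>N. t = t'" unfolding N_def using unique by blast
    ultimately    show ?thesis using card_le_Suc0_iff_eq[of N] by blast
  qed
  have cI: "card I \<le> Suc 0"
  proof -
    have "finite I" using finT0 by (simp add: I_def)
    moreover have "\<forall>t\<in>I. \<forall>t'\<in>I. t = t'" using inv_unique by blast
    ultimately    show ?thesis using card_le_Suc0_iff_eq[of I] by blast
  qed
  have T0: "T0 = {\<one>} \<union> N \<union> I" using one_in_T by (auto simp: T0_def N_def I_def)
  have "card T0 \<le> card ({\<one>} \<union> N) + card I"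
    unfolding T0 by (rule card_Un_le)
  moreover have "card ({\<one>} \<union> N) \<le> Suc (card N)"
    using card_Un_le[of "{\<one>}" N] by simp
  ultimately have "p \<le> Suc (card N) + card I" unfolding card_T0 by linarith
  then have p3: "p = 3" and cards: "card N = 1" "card I = 1" using cN cI p_ge3 by linarith+
  obtain t s where N: "N = {t}" and I: "I = {s}" using cards by (metis card_1_singletonE)
  have "t \<in> N" "s \<in> I" using N I by simp_all
  then have t: "t \<in> carrier G" "t \<otimes> x = x \<otimes> t" "t \<otimes> t \<noteq> \<one>"
    and s: "s \<in> carrier G" "s \<otimes> x = x \<otimes> s" "s \<otimes> s = \<one>" "s \<noteq> \<one>"
    unfolding N_def I_def T0_def using T_carrier by blast+
  have T0': "T0 = {\<one>, s, t}" unfolding T0 N I by blast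
  obtain e where e: "e \<in> Om" using Om_nonempty by blast
  obtain i where i: "t = x [^] (i::int) \<or> t = x [^] i \<otimes> s"
    using centralizer_in_orb[OF t(1,2) e] centralizer_not_in_orb[OF t(1,2) s(1,2) e]
      involution_not_in_orb[OF s e] by blast
  \<comment> \<open>Renaming the generator of <x> turns t = x^i or x^i s into the form z or z s
    required by \<open>no_small_centralizer\<close>. The set \<open>T0\<close> stays the same, as x
    and z are powers of each other.\<close>
  define z where "z = x [^] i"
  have z: "z \<in> carrier G" "z [^] p = \<one>"
  proof -
    have "z [^] int p = (x [^] int p) [^] i" by (simp add: z_def int_pow_pow mult.commute)
    then show "z [^] p = \<one>" using x_pow by (simp add: int_pow_int)
  qed (simp add: z_def)
  have sz: "s \<otimes> z = z \<otimes> s" using commute_int_pow s by (simp add: z_def)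
  have ndvd: "\<not> int p dvd i"
  proof
    assume "int p dvd i"
    then have "z = \<one>" by (simp only: z_def x_int_pow_eq_one)
    then show False using i s t by (auto simp: z_def)
  qed
  then have z1: "z \<noteq> \<one>" by (simp add: z_def x_int_pow_eq_one)
  interpret Z: fixed_point_free_element G act Om T p z
    using z z1 fixed_point_free by unfold_locales
  have "{t \<in> T. t \<otimes> z = z \<otimes> t} = T0"
    using commute_int_pow commute_x_of_commute_pow[of _ i] ndvd unfolding T0_def z_def by auto
  then show False
    using Z.no_small_centralizer[OF p3 s(1) sz s(3,4), of t] i T0' by (simp add: z_def)
qed

end

section \<open>The affine cases\<close>

lemma carrier_affine_group: "carrier (affine_group p) = {1..<int p} \<times> {0..<int p}"
  and one_affine_group: "\<one>\<^bsub>affine_group p\<^esub> = (1, 0)"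
  and mult_affine_group: "(a, b) \<otimes>\<^bsub>affine_group p\<^esub> (c, d) = ((a * c) mod int p, (a * d + b) mod int p)"
  by (simp_all add: affine_group_def)

lemma mod_mult_add_eq: "(a mod n * (b mod n) + c mod n) mod n = (a * b + c) mod (n::int)"
  unfolding cong_def[symmetric] by (intro cong_add cong_mult) (simp_all add: cong_def)

lemma mod_prime_nonzero: "Factorial_Ring.prime p \<Longrightarrow> \<not> int p dvd a \<Longrightarrow> a mod int p \<in> {1..<int p}"
proof -
  assume p: "Factorial_Ring.prime p" "\<not> int p dvd a"
  then have "0 < int p" using prime_gt_0_nat by simp
  then have "0 \<le> a mod int p" "a mod int p < int p" by simp_all
  moreover have "a mod int p \<noteq> 0" using p by (simp add: dvd_eq_mod_eq_0)
  ultimately show ?thesis by simp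
qed

lemma not_dvd_of_mem: "a \<in> {1..<int p} \<Longrightarrow> \<not> int p dvd a"
  by (auto dest: zdvd_imp_le)

lemma group_affine_group:
  assumes p: "Factorial_Ring.prime p"
  shows "group (affine_group p)"
proof (rule groupI)
  have p1: "1 < int p" using prime_gt_1_nat[OF p] by simp
  have pp: "Factorial_Ring.prime (int p)" using p by simp
  show "\<one>\<^bsub>affine_group p\<^esub> \<in> carrier (affine_group p)"
    using p1 by (simp add: carrier_affine_group one_affine_group)
  fix g assume g: "g \<in> carrier (affine_group p)"
  obtain a b where ab: "g = (a, b)" "a \<in> {1..<int p}" "b \<in> {0..<int p}"
    using g by (auto simp: carrier_affine_group)
  show "\<one>\<^bsub>affine_group p\<^esub> \<otimes>\<^bsub>affine_group p\<^esub> g = g"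
    using ab by (simp add: one_affine_group mult_affine_group)
  have "coprime a (int p)"
    using not_dvd_of_mem[OF ab(2)] pp by (metis prime_imp_coprime coprime_commute)
  then obtain c where "[a * c = 1] (mod int p)" using cong_solve_coprime_int by blast
  then have ca: "(c * a) mod int p = 1" using p1 by (simp add: cong_def mult.commute)
  then have c: "\<not> int p dvd c" by (metis dvd_eq_mod_eq_0 dvd_mult2 zero_neq_one)
  have "(c mod int p, (- (c * b)) mod int p) \<in> carrier (affine_group p)"
    using mod_prime_nonzero[OF p c] p1 by (simp add: carrier_affine_group)
  moreover have "(c mod int p, (- (c * b)) mod int p) \<otimes>\<^bsub>affine_group p\<^esub> g = \<one>\<^bsub>affine_group p\<^esub>"
  proof -
    have "(c mod int p * b + (- (c * b)) mod int p) mod int p = (c mod int p * b + - (c * b)) mod int p"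
      by (rule mod_add_right_eq)
    also have "\<dots> = ((c mod int p * b) mod int p + - (c * b)) mod int p"
      by (rule mod_add_left_eq[symmetric])
    also have "\<dots> = (c * b + - (c * b)) mod int p"
      by (simp only: mod_mult_left_eq mod_add_left_eq)
    finally show ?thesis
      using ca by (simp add: ab mult_affine_group one_affine_group mod_mult_left_eq)
  qed
  ultimately show "\<exists>h\<in>carrier (affine_group p). h \<otimes>\<^bsub>affine_group p\<^esub> g = \<one>\<^bsub>affine_group p\<^esub>" by blast
  fix h assume h: "h \<in> carrier (affine_group p)"
  obtain c d where cd: "h = (c, d)" "c \<in> {1..<int p}" "d \<in> {0..<int p}"
    using h by (auto simp: carrier_affine_group)
  have "\<not> int p dvd a * c"
    using not_dvd_of_mem[OF ab(2)] not_dvd_of_mem[OF cd(2)] pp by (simp add: prime_dvd_mult_iff)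
  then show "g \<otimes>\<^bsub>affine_group p\<^esub> h \<in> carrier (affine_group p)"
    using mod_prime_nonzero[OF p] p1 unfolding ab cd mult_affine_group carrier_affine_group by auto
  fix k assume k: "k \<in> carrier (affine_group p)"
  then show "g \<otimes>\<^bsub>affine_group p\<^esub> h \<otimes>\<^bsub>affine_group p\<^esub> k = g \<otimes>\<^bsub>affine_group p\<^esub> (h \<otimes>\<^bsub>affine_group p\<^esub> k)"
  proof (cases k)
    case (Pair u v)
    have "(a * c mod int p * v + (a * d + b) mod int p) mod int p = (a * ((c * v + d) mod int p) + b) mod int p"
      unfolding cong_def[symmetric]
    proof (rule cong_trans)
      show "[a * c mod int p * v + (a * d + b) mod int p = a * c * v + (a * d + b)] (mod int p)"
        by (intro cong_add cong_mult) (simp_all add: cong_def)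
      have "[a * (c * v + d) + b = a * ((c * v + d) mod int p) + b] (mod int p)"
        by (intro cong_add cong_mult) (simp_all add: cong_def)
      then show "[a * c * v + (a * d + b) = a * ((c * v + d) mod int p) + b] (mod int p)"
        by (simp add: algebra_simps)
    qed
    then show ?thesis
      by (simp add: ab cd Pair mult_affine_group mod_mult_left_eq mod_mult_right_eq mult.assoc)
  qed
qed

lemma order_affine_group: "order (affine_group p) = (p - 1) * p"
proof -
  have "nat (int p - 1) = p - 1" by linarith
  then show ?thesis by (simp add: order_def carrier_affine_group card_cartesian_product)
qed

text \<open>The linear part is multiplicative. Together with Fermat's theorem this shows that an
  affine map whose p-th power is the identity is a translation.\<close>

lemma fst_affine_pow:
  assumes "1 < p"
  shows "fst ((u, v) [^]\<^bsub>affine_group p\<^esub> (n::nat)) = u ^ n mod int p"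
proof (induction n)
  case 0
  then show ?case using assms by (simp add: one_affine_group)
next
  case (Suc n)
  obtain c d where cd: "(u, v) [^]\<^bsub>affine_group p\<^esub> n = (c, d)" by (metis surj_pair)
  then show ?case using Suc by (simp add: mult_affine_group mod_mult_left_eq mod_mult_right_eq mult.commute)
qed

lemma iso_to_subgroup_of_inj_hom:
  assumes "group G" "group A" and \<phi>: "\<phi> \<in> hom G A" "inj_on \<phi> (carrier G)"
  shows "iso_to_subgroup G A"
proof -
  interpret group_hom G A \<phi> using assms by (simp add: group_hom_def group_hom_axioms_def)
  have "subgroup (\<phi> ` carrier G) A" by (rule img_is_subgroup)
  moreover have "\<phi> \<in> iso G (A\<lparr>carrier := \<phi> ` carrier G\<rparr>)"
    using \<phi> by (auto simp: iso_def hom_def bij_betw_def)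
  ultimately show ?thesis unfolding iso_to_subgroup_def is_iso_def by blast
qed

lemma inj_hom_of_iso_to_subgroup:
  assumes "iso_to_subgroup G A"
  obtains \<phi> where "\<phi> \<in> hom G A" "inj_on \<phi> (carrier G)"
proof -
  obtain S \<phi> where S: "subgroup S A" "\<phi> \<in> iso G (A\<lparr>carrier := S\<rparr>)"
    using assms unfolding iso_to_subgroup_def is_iso_def by blast
  then have "\<phi> \<in> hom G A" "inj_on \<phi> (carrier G)"
    using subgroup.subset[OF S(1)] by (auto simp: iso_def hom_def bij_betw_def)
  then show ?thesis by (rule that)
qed

lemma order_dvd_of_iso_to_subgroup:
  assumes "group A" "iso_to_subgroup G A"
  shows "order G dvd order A"
proof -
  obtain S where S: "subgroup S A" "G \<cong> A\<lparr>carrier := S\<rparr>"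
    using assms unfolding iso_to_subgroup_def by blast
  then have "order G = card S" using iso_same_card[OF S(2)] by (simp add: order_def)
  then show ?thesis using group.lagrange[OF assms(1) S(1)] by (metis dvd_triv_right)
qed

text \<open>In a finite group the inverse is the power with exponent \<open>order G - 1\<close>.
  This spares \<open>odd_card_K\<close> negative powers of an integer that is invertible only modulo
  p.\<close>

lemma (in group) subgroup_of_mult_closed:
  assumes "finite (carrier G)" "S \<subseteq> carrier G" "\<one> \<in> S"
    and mult: "\<And>a b. a \<in> S \<Longrightarrow> b \<in> S \<Longrightarrow> a \<otimes> b \<in> S"
  shows "subgroup S G"
proof (rule subgroupI)
  fix a assume a: "a \<in> S"
  then have ac: "a \<in> carrier G" using assms by blast
  have pow: "a [^] (n::nat) \<in> S" for n by (induction n) (simp_all add: assms a)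
  have "0 < order G" using assms(1) by (simp add: order_gt_0_iff_finite)
  then have "a [^] (order G - 1) \<otimes> a = \<one>"
    using pow_order_eq_1[OF ac] by (metis Suc_diff_1 nat_pow_Suc)
  then have "inv a = a [^] (order G - 1)" using ac by (intro inv_equality) simp_all
  then show "inv a \<in> S" using pow by simp
qed (use assms in auto)

section \<open>The action of G on <x> by conjugation\<close>

context fixed_point_free_element
begin

lemma x_normal:
  assumes "g \<in> carrier G"
  shows "\<exists>i::int. g \<otimes> x \<otimes> inv g = x [^] i"
proof (rule prime_order_unique)
  show "(g \<otimes> x \<otimes> inv g) [^] p = \<one>"
    using conj_int_pow[OF assms x_carrier, of "int p"] assms x_pow by (simp add: int_pow_int)
qed (use assms in simp)

definition multiplier :: "'a \<Rightarrow> int" where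
  "multiplier g = (SOME i. g \<otimes> x \<otimes> inv g = x [^] i)"

lemma x_int_pow_eq_cong: "x [^] (i::int) = x [^] j \<longleftrightarrow> [i = j] (mod int p)"
  by (simp add: x_int_pow_eq cong_iff_dvd_diff)

lemma multiplier: "g \<in> carrier G \<Longrightarrow> g \<otimes> x \<otimes> inv g = x [^] multiplier g"
  unfolding multiplier_def using x_normal by (rule someI_ex)

lemma multiplier_pow: "g \<in> carrier G \<Longrightarrow> g \<otimes> x [^] (i::int) = x [^] (multiplier g * i) \<otimes> g"
proof -
  assume g: "g \<in> carrier G"
  then have "g \<otimes> x [^] i \<otimes> inv g = x [^] (multiplier g * i)"
    using conj_int_pow[of g x i] by (simp add: multiplier int_pow_pow)
  then show ?thesis using g conj_eq_iff[of g "x [^] i" "x [^] (multiplier g * i)"] by simp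
qed

lemma multiplier_cong:
  assumes "g \<in> carrier G" "g \<otimes> x = x [^] i \<otimes> g"
  shows "[multiplier g = i] (mod int p)"
proof -
  have "g \<otimes> x \<otimes> inv g = x [^] i" using assms conj_eq_iff[of g x "x [^] i"] by simp
  then show ?thesis using multiplier[OF assms(1)] by (simp add: x_int_pow_eq_cong)
qed

lemma multiplier_mult:
  assumes "g \<in> carrier G" "h \<in> carrier G"
  shows "[multiplier (g \<otimes> h) = multiplier g * multiplier h] (mod int p)"
proof (rule multiplier_cong)
  have "g \<otimes> h \<otimes> x = g \<otimes> (h \<otimes> x [^] (1::int))" using assms by (simp add: m_assoc)
  also have "\<dots> = g \<otimes> x [^] multiplier h \<otimes> h"
    unfolding multiplier_pow[OF assms(2)] using assms by (simp add: m_assoc)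
  also have "\<dots> = x [^] (multiplier g * multiplier h) \<otimes> (g \<otimes> h)"
    unfolding multiplier_pow[OF assms(1)] using assms by (simp add: m_assoc)
  finally show "g \<otimes> h \<otimes> x = x [^] (multiplier g * multiplier h) \<otimes> (g \<otimes> h)" .
qed (use assms in simp)

lemma multiplier_one_iff:
  assumes "g \<in> carrier G"
  shows "[multiplier g = 1] (mod int p) \<longleftrightarrow> g \<otimes> x = x \<otimes> g"
proof
  assume "[multiplier g = 1] (mod int p)"
  then have "x [^] multiplier g = x [^] (1::int)" by (simp only: x_int_pow_eq_cong)
  then have "g \<otimes> x \<otimes> inv g = x" using multiplier[OF assms] by simp
  then show "g \<otimes> x = x \<otimes> g" using assms by (simp only: conj_eq_iff x_carrier)
qed (use multiplier_cong[of g 1] assms in simp)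

lemma multiplier_not_dvd:
  assumes "g \<in> carrier G"
  shows "\<not> int p dvd multiplier g"
proof
  assume "int p dvd multiplier g"
  then have "g \<otimes> x \<otimes> inv g = \<one>" using multiplier[OF assms] x_int_pow_eq_one by metis
  then show False using assms x_neq_one by (simp add: conj_eq_iff)
qed

lemma act_orb:
  assumes g: "g \<in> carrier G" and \<alpha>: "\<alpha> \<in> Om" and \<beta>: "\<beta> \<in> A.orb \<alpha>"
  shows "act g \<beta> \<in> A.orb (act g \<alpha>)"
proof -
  obtain i where "\<beta> = act (x [^] (i::int)) \<alpha>" using \<beta> by (auto simp: A.orb_def)
  then have "act g \<beta> = act (g \<otimes> x [^] i) \<alpha>" using g \<alpha> by simp
  also have "\<dots> = act (x [^] (multiplier g * i)) (act g \<alpha>)"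
    unfolding multiplier_pow[OF g] using g \<alpha> by simp
  finally show ?thesis by (auto simp: A.orb_def)
qed

lemma act_orb_iff:
  assumes g: "g \<in> carrier G" and \<alpha>: "\<alpha> \<in> Om" and \<beta>: "\<beta> \<in> Om"
  shows "act g \<beta> \<in> A.orb (act g \<alpha>) \<longleftrightarrow> \<beta> \<in> A.orb \<alpha>"
  using act_orb[OF g \<alpha>, of \<beta>] act_orb[of "inv g" "act g \<alpha>" "act g \<beta>"] g \<alpha> \<beta> by auto

end

section \<open>Numbering the two orbits from e and f, and the homomorphism to Aff(1,p)\<close>

locale fixed_point_free_based = fixed_point_free_element +
  fixes e f
  assumes e: "e \<in> Om" and f: "f \<in> Om" "f \<notin> A.orb e"
begin

lemma Om_halves: "Om = A.orb e \<union> A.orb f"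
  using two_orbits e f by blast

lemma orb_f: "\<alpha> \<in> Om \<Longrightarrow> \<alpha> \<in> A.orb f \<longleftrightarrow> \<alpha> \<notin> A.orb e"
  using Om_halves A.orb_disjoint[OF e f] by blast

lemma orb_permuted:
  assumes g: "g \<in> carrier G" and \<alpha>: "\<alpha> \<in> Om"
  shows "act g \<alpha> \<in> A.orb e \<longleftrightarrow> (\<alpha> \<in> A.orb e \<longleftrightarrow> act g e \<in> A.orb e)"
proof -
  have orb: "\<gamma> \<in> A.orb \<delta> \<longleftrightarrow> (\<gamma> \<in> A.orb e \<longleftrightarrow> \<delta> \<in> A.orb e)" if "\<gamma> \<in> Om" "\<delta> \<in> Om" for \<gamma> \<delta>
  proof (cases "\<delta> \<in> A.orb e")
    case True
    then show ?thesis using A.orb_eq[OF e True] by simp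
  next
    case False
    then have "Om = A.orb e \<union> A.orb \<delta>" "A.orb e \<inter> A.orb \<delta> = {}"
      using two_orbits[OF e that(2)] A.orb_disjoint[OF e that(2)] by blast+
    then show ?thesis using that False by blast
  qed
  show ?thesis
    using act_orb_iff[OF g e \<alpha>] orb[of "act g \<alpha>" "act g e"] g \<alpha> e by auto
qed

lemma permutes_orb: "g \<in> carrier G \<Longrightarrow> permutes_halves (A.orb e) g"
  unfolding permutes_halves_def using orb_permuted[of g] by (intro exI[of _ "act g e \<in> A.orb e"]) blast

text \<open>\<open>lab\<close> and \<open>multiplier\<close> are integers that are only meaningful modulo \<open>p\<close>.\<close>
definition lab :: "'c \<Rightarrow> int" where
  "lab \<alpha> = (SOME i. \<alpha> = act (x [^] i) e \<or> \<alpha> = act (x [^] i) f)"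

lemma lab: "\<alpha> \<in> Om \<Longrightarrow> \<alpha> = act (x [^] lab \<alpha>) e \<or> \<alpha> = act (x [^] lab \<alpha>) f"
  unfolding lab_def by (rule someI_ex) (use Om_halves in \<open>auto simp: A.orb_def\<close>)

lemma lab_orb:
  assumes b: "b \<in> {e, f}" and \<alpha>: "\<alpha> \<in> A.orb b"
  shows "\<alpha> = act (x [^] lab \<alpha>) b"
proof -
  have "\<alpha> \<in> Om" using b \<alpha> Om_halves by auto
  then show ?thesis
    using lab[of \<alpha>] b \<alpha> orb_f[of \<alpha>] A.orb_def by blast
qed

lemma lab_cong:
  assumes b: "b \<in> {e, f}"
  shows "[lab (act (x [^] (i::int)) b) = i] (mod int p)"
proof -
  have bO: "b \<in> Om" using b e f by blast
  have "act (x [^] i) b = act (x [^] lab (act (x [^] i) b)) b"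
    by (rule lab_orb[OF b]) (simp add: A.orb_def)
  then have "int p dvd i - lab (act (x [^] i) b)"
    using A.eq_iff_dvd[OF bO moved[OF bO]] by blast
  then show ?thesis by (simp add: cong_iff_dvd_diff dvd_diff_commute)
qed

lemma lab_shift:
  assumes "\<alpha> \<in> Om"
  shows "[lab (act (x [^] (k::int)) \<alpha>) = k + lab \<alpha>] (mod int p)"
proof -
  obtain b where b: "b \<in> {e, f}" "\<alpha> = act (x [^] lab \<alpha>) b" using lab[OF assms] by blast
  have "b \<in> Om" using b e f by blast
  then have "act (x [^] k) \<alpha> = act (x [^] (k + lab \<alpha>)) b"
    using b(2) A.add by metis
  then show ?thesis using lab_cong[OF b(1)] by metis
qed

lemma lab_act:
  assumes g: "g \<in> carrier G" and b: "b \<in> {e, f}" and \<alpha>: "\<alpha> \<in> A.orb b"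
  shows "[lab (act g \<alpha>) = multiplier g * lab \<alpha> + lab (act g b)] (mod int p)"
proof -
  have bO: "b \<in> Om" using b e f by blast
  have "act g \<alpha> = act (g \<otimes> x [^] lab \<alpha>) b"
    using lab_orb[OF b \<alpha>] g bO by (metis act_mult int_pow_closed x_carrier)
  also have "\<dots> = act (x [^] (multiplier g * lab \<alpha>)) (act g b)"
    unfolding multiplier_pow[OF g] using g bO by simp
  finally show ?thesis using lab_shift g bO by simp
qed

text \<open>On each single orbit the translation part is only a cocycle twisted by the interchange of the two
  orbits; the sum over both orbits is a cocycle for the multiplier alone.\<close>
definition shift :: "'a \<Rightarrow> int" where
  "shift g = lab (act g e) + lab (act g f)"

lemma shift_mult:
  assumes g: "g \<in> carrier G" and h: "h \<in> carrier G"
  shows "[shift (g \<otimes> h) = multiplier g * shift h + shift g] (mod int p)"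
proof -
  \<comment> \<open>The images of e and f under h lie in different orbits. Whether or not h
    interchanges the orbits, b and c are e and f in some order, so the translation parts of g add up
    to \<open>shift g\<close>.\<close>
  obtain b c where bc: "act h e \<in> A.orb b" "act h f \<in> A.orb c" "b = e \<and> c = f \<or> b = f \<and> c = e"
    using orb_permuted[OF h f(1)] orb_f[of "act h e"] orb_f[of "act h f"] e f h by auto
  have "[shift (g \<otimes> h) = (multiplier g * lab (act h e) + lab (act g b)) + (multiplier g * lab (act h f) + lab (act g c))] (mod int p)"
  proof -
    have "b \<in> {e, f}" "c \<in> {e, f}" using bc(3) by auto
    then show ?thesis
      using cong_add[OF lab_act[OF g _ bc(1)] lab_act[OF g _ bc(2)]] g h e f(1) by (simp add: shift_def)
  qed
  then show ?thesis using bc(3) by (auto simp: shift_def algebra_simps)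
qed

definition to_affine :: "'a \<Rightarrow> int \<times> int" where
  "to_affine g = (multiplier g mod int p, shift g mod int p)"

lemma to_affine_hom: "to_affine \<in> hom G (affine_group p)"
proof (rule homI)
  fix g assume g: "g \<in> carrier G"
  then show "to_affine g \<in> carrier (affine_group p)"
    using mod_prime_nonzero[OF prime_p multiplier_not_dvd[OF g]] p_ge3
    by (simp add: to_affine_def carrier_affine_group)
  fix h assume h: "h \<in> carrier G"
  show "to_affine (g \<otimes> h) = to_affine g \<otimes>\<^bsub>affine_group p\<^esub> to_affine h"
    using multiplier_mult[OF g h] shift_mult[OF g h]
    by (simp add: to_affine_def mult_affine_group cong_def mod_mult_add_eq mod_mult_eq)
qed

text \<open>Trivial multiplier means commuting with x. A power x^i raises the labels of e and f by i
  each, so its shift is 2i, which vanishes modulo the odd prime p only if p divides i.\<close>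

lemma to_affine_kernel:
  assumes g: "g \<in> carrier G" and one: "to_affine g = \<one>\<^bsub>affine_group p\<^esub>"
  shows "g \<otimes> x = x \<otimes> g" "g = x [^] (i::int) \<Longrightarrow> g = \<one>"
proof -
  have "multiplier g mod int p = 1" "shift g mod int p = 0"
    using one by (simp_all add: to_affine_def one_affine_group)
  then have 1: "[multiplier g = 1] (mod int p)" "[shift g = 0] (mod int p)"
    using p_ge3 by (simp_all add: cong_def)
  then show "g \<otimes> x = x \<otimes> g" using multiplier_one_iff g by blast
  assume i: "g = x [^] i"
  have "[shift g = i + i] (mod int p)"
    unfolding i shift_def using lab_cong by (intro cong_add) simp_all
  then have "[i + i = 0] (mod int p)" using 1(2) cong_sym cong_trans by blast
  then have "int p dvd 2 * i" by (simp add: cong_0_iff)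
  then show "g = \<one>" unfolding i by (simp only: dvd_double x_int_pow_eq_one)
qed

abbreviation K :: "'a set" where "K \<equiv> block_stab e (A.orb e)"

lemma K_normal: "K \<lhd> G" and K_index: "card (rcosets K) = 2"
  and K_mult: "g \<in> carrier G \<Longrightarrow> h \<in> carrier G \<Longrightarrow> g \<otimes> h \<in> K \<longleftrightarrow> (g \<in> K \<longleftrightarrow> h \<in> K)"
  using block_stab_index_two[OF permutes_orb e A.self_in_orb[OF e] f] by blast+

lemma K_centralizer: "g \<in> K \<Longrightarrow> g \<otimes> x = x \<otimes> g \<Longrightarrow> \<exists>i::int. g = x [^] i"
  using centralizer_in_orb[OF _ _ e] by (simp add: block_stab_def)

lemma x_pow_in_K: "x [^] (i::int) \<in> K"
  by (simp add: block_stab_def A.orb_def)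

lemma card_T_K: "card (T \<inter> K) = p"
proof -
  have "\<beta> \<in> (\<lambda>t. act t e) ` (T \<inter> K)" if \<beta>: "\<beta> \<in> A.orb e" for \<beta>
  proof -
    obtain t where "t \<in> T" "act t e = \<beta>" using T_sharp[OF e, of \<beta>] A.orb_subset[OF e] \<beta> by blast
    then show ?thesis using \<beta> by (auto simp: block_stab_def)
  qed
  then have "(\<lambda>t. act t e) ` (T \<inter> K) = A.orb e" by (auto simp: block_stab_def)
  moreover have "inj_on (\<lambda>t. act t e) (T \<inter> K)"
    using inj_on_subset[OF bij_betw_imp_inj_on[OF T_bij[OF e]]] by blast
  ultimately have "card (T \<inter> K) = card (A.orb e)" by (metis card_image)
  then show ?thesis using A.card_orb[OF e moved[OF e]] by simp
qed

lemma card_x_pow: "card (range (\<lambda>i::int. x [^] i)) = p"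
proof -
  have "range (\<lambda>i::int. x [^] i) = generate G {x}" using generate_pow[of x] by auto
  then show ?thesis
    using generate_pow_card[of x] prime_ord[OF x_carrier x_pow x_neq_one prime_p] by simp
qed

text \<open>A non-trivial orbit of \<open>\<langle>x\<rangle>\<close> on \<open>T\<close> has \<open>p\<close> elements, so if it met \<open>K\<close> it would exhaust
  \<open>T \<inter> K\<close>, which contains \<open>1\<close>.\<close>
lemma T_K_centralizes:
  assumes "t \<in> T \<inter> K"
  shows "t \<otimes> x = x \<otimes> t"
proof (rule ccontr)
  assume nc: "t \<otimes> x \<noteq> x \<otimes> t"
  have t: "t \<in> T" using assms by blast
  let ?N = "{t \<in> T. t \<otimes> x \<noteq> x \<otimes> t}"
  have "?N \<subseteq> T \<inter> K"
  proof
    fix u assume u: "u \<in> ?N"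
    then obtain i where "u = x [^] (i::int) \<otimes> t \<otimes> inv (x [^] i)"
      using T_noncommuting_orbit(1)[OF x_carrier x_pow t nc] by blast
    then have "u \<otimes> x [^] i = x [^] i \<otimes> t" using t by (simp add: m_assoc)
    moreover have "x [^] i \<otimes> t \<in> K" using assms x_pow_in_K[of i] K_mult t by simp
    ultimately have "u \<in> K" using K_mult[of u "x [^] i"] x_pow_in_K[of i] u by simp
    then show "u \<in> T \<inter> K" using u by blast
  qed
  then have "?N = T \<inter> K"
    using card_T_K T_noncommuting_orbit(2)[OF x_carrier x_pow t nc] finite_T
    by (intro card_subset_eq) auto
  moreover have "\<one> \<in> T \<inter> K" using one_in_T x_pow_in_K[of 0] by simp
  ultimately have "\<one> \<in> ?N" by blast
  then show False by simp
qed

text \<open>The left side lies in the centralizer of x within K, which is <x>, and both sides have p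
  elements. So the subgroup generated by the left side is <x>, which is normal.\<close>

lemma T_K: "T \<inter> K = range (\<lambda>i::int. x [^] i)"
proof (rule card_subset_eq)
  show "finite (range (\<lambda>i::int. x [^] i))"
    by (rule finite_subset[OF _ finite_carrier]) auto
  show "T \<inter> K \<subseteq> range (\<lambda>i::int. x [^] i)"
    using T_K_centralizes K_centralizer by blast
qed (simp add: card_T_K card_x_pow)

lemma generate_T_K: "generate G (T \<inter> K) \<lhd> G" "card (generate G (T \<inter> K)) = p"
proof -
  have P: "range (\<lambda>i::int. x [^] i) = generate G {x}" using generate_pow[of x] by auto
  have sub: "subgroup (range (\<lambda>i::int. x [^] i)) G"
    unfolding P by (rule generate_is_subgroup) simp
  then have gen: "generate G (T \<inter> K) = range (\<lambda>i::int. x [^] i)"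
    unfolding T_K by (meson equalityI generate_subgroup_incl generate.incl subsetI)
  show "card (generate G (T \<inter> K)) = p" unfolding gen by (rule card_x_pow)
  show "generate G (T \<inter> K) \<lhd> G"
    unfolding gen
  proof (rule normal_invI[OF sub])
    fix g h assume g: "g \<in> carrier G" and "h \<in> range (\<lambda>i::int. x [^] i)"
    then obtain i where h: "h = x [^] (i::int)" by blast
    have "g \<otimes> h \<otimes> inv g = x [^] (multiplier g * i)"
      unfolding h using conj_int_pow[OF g x_carrier, of i] by (simp add: multiplier[OF g] int_pow_pow)
    then show "g \<otimes> h \<otimes> inv g \<in> range (\<lambda>i::int. x [^] i)" by blast
  qed
qed

text \<open>A kernel element g centralizes x, and g^2 lies in <x>. As p is odd, g is a power of x
  times an element of square 1. Without involutions g itself lies in <x>, where the kernel is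
  trivial.\<close>

lemma iso_affine_if_no_involution:
  assumes no_inv: "\<And>s. s \<in> carrier G \<Longrightarrow> s \<otimes> x = x \<otimes> s \<Longrightarrow> s \<otimes> s = \<one> \<Longrightarrow> s = \<one>"
  shows "iso_to_subgroup G (affine_group p)"
proof (rule iso_to_subgroup_of_inj_hom[OF group_axioms group_affine_group[OF prime_p] to_affine_hom])
  have "g = \<one>" if g: "g \<in> carrier G" "to_affine g = \<one>\<^bsub>affine_group p\<^esub>" for g
  proof -
    have gx: "g \<otimes> x = x \<otimes> g" using to_affine_kernel(1)[OF g] .
    obtain i where i: "g \<otimes> g = x [^] (i::int)" using centralizer_square[OF g(1) gx] by blast
    obtain n where n: "int p = 2 * n + 1" using odd_p oddE[of "int p"] by auto
    \<comment> \<open>With p = 2n + 1 and g^2 = x^i, the square of g x^(in) is x^(i + 2in) = x^(ip)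
      = 1.\<close>
    define s where "s = g \<otimes> x [^] (i * n)"
    have s: "s \<in> carrier G" "s \<otimes> x = x \<otimes> s"
      unfolding s_def using g gx commute_mult[OF g(1) _ gx pow_commute] by simp_all
    have "s \<otimes> s = g \<otimes> (x [^] (i * n) \<otimes> g) \<otimes> x [^] (i * n)"
      using g by (simp add: s_def m_assoc)
    also have "\<dots> = (g \<otimes> g) \<otimes> (x [^] (i * n) \<otimes> x [^] (i * n))"
      unfolding commute_int_pow[OF g(1) gx, symmetric] using g by (simp add: m_assoc)
    also have "\<dots> = x [^] (i + (i * n + i * n))"
      unfolding i by (simp only: int_pow_mult x_carrier)
    also have "i + (i * n + i * n) = i * int p" unfolding n by (simp add: algebra_simps)
    finally have "s \<otimes> s = \<one>" using x_int_pow_eq_one[of "i * int p"] by simp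
    then have "s = \<one>" using no_inv s by blast
    then have "g = inv (x [^] (i * n))" using g unfolding s_def by (metis inv_equality int_pow_closed x_carrier)
    then have "g = x [^] (- (i * n))" by (simp add: int_pow_neg)
    then show ?thesis using to_affine_kernel(2)[OF g] by blast
  qed
  then show "inj_on to_affine (carrier G)"
    using inj_on_one_iff'[OF to_affine_hom group_axioms group_affine_group[OF prime_p]] by blast
qed

end

section \<open>Obstructions that make the three cases exclusive\<close>

context group
begin

lemma generate_involution:
  assumes "a \<in> carrier G" "a \<otimes> a = \<one>"
  shows "generate G {a} = {\<one>, a}"
proof
  have "inv a = a" using assms by (simp add: inv_equality)
  then have "subgroup {\<one>, a} G"
    using assms by (intro subgroupI) auto
  then show "generate G {a} \<subseteq> {\<one>, a}" by (intro generate_subgroup_incl) auto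
  show "{\<one>, a} \<subseteq> generate G {a}" using generate.one generate.incl[of a "{a}"] by auto
qed

text \<open>An affine map commuting with a non-trivial translation is a translation.\<close>
lemma not_affine_if_commuting_involution:
  assumes p: "Factorial_Ring.prime p" "odd p"
    and x: "x \<in> carrier G" "x [^] p = \<one>" "x \<noteq> \<one>"
    and a: "a \<in> carrier G" "a \<otimes> a = \<one>" "a \<noteq> \<one>" and ax: "a \<otimes> x = x \<otimes> a"
  shows "\<not> iso_to_subgroup G (affine_group p)"
proof
  let ?A = "affine_group p"
  assume "iso_to_subgroup G ?A"
  then obtain \<phi> where \<phi>: "\<phi> \<in> hom G ?A" "inj_on \<phi> (carrier G)" by (rule inj_hom_of_iso_to_subgroup)
  interpret group_hom G ?A \<phi>
    using \<phi> group_affine_group[OF p(1)] group_axioms by (simp add: group_hom_def group_hom_axioms_def)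
  have p1: "1 < p" using prime_gt_1_nat[OF p(1)] .
  obtain u v where uv: "\<phi> x = (u, v)" "u \<in> {1..<int p}" "v \<in> {0..<int p}"
    using hom_closed[OF x(1)] by (auto simp: carrier_affine_group)
  obtain c d where cd: "\<phi> a = (c, d)" "c \<in> {1..<int p}" "d \<in> {0..<int p}"
    using hom_closed[OF a(1)] by (auto simp: carrier_affine_group)
  have pp: "Factorial_Ring.prime (int p)" using p(1) by simp
  have "\<phi> x [^]\<^bsub>?A\<^esub> p = \<one>\<^bsub>?A\<^esub>"
    using hom_nat_pow[OF x(1), of p] x(2) by simp
  then have up: "u ^ p mod int p = 1"
    using fst_affine_pow[OF p1, of u v p] by (simp add: uv one_affine_group)
  \<comment> \<open>Fermat's theorem gives u^p = u modulo p. Since also u^p = 1, the image of x is a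
    translation, by some v that is not 0.\<close>
  have "\<not> p dvd nat u" using not_dvd_of_mem[OF uv(2)] uv(2) by (metis atLeastLessThan_iff int_dvd_int_iff nat_0_le order_trans zero_le_one)
  then have "[nat u ^ (p - 1) = 1] (mod p)" using fermat_theorem[OF p(1)] by blast
  then have "[int (nat u ^ (p - 1)) = int 1] (mod int p)" by (simp only: cong_int_iff)
  then have "[u ^ (p - 1) = 1] (mod int p)" using uv(2) by simp
  then have "[u * u ^ (p - 1) = u * 1] (mod int p)" by (intro cong_mult) simp_all
  then have "[u ^ p = u] (mod int p)" using p1 by (simp flip: power_Suc)
  then have u: "u = 1" using up uv(2) p1 by (simp add: cong_def)
  have v: "v \<noteq> 0"
  proof
    assume "v = 0"
    then have "\<phi> x = \<phi> \<one>" using uv u by (simp add: one_affine_group)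
    then show False using inj_onD[OF \<phi>(2), of x \<one>] x by blast
  qed
  have "\<phi> a \<otimes>\<^bsub>?A\<^esub> \<phi> x = \<phi> x \<otimes>\<^bsub>?A\<^esub> \<phi> a" using a x ax by (metis hom_mult)
  then have "(c * v + d) mod int p = (d + v) mod int p" by (simp add: uv cd u mult_affine_group)
  then have "int p dvd (c - 1) * v" by (simp add: mod_eq_dvd_iff algebra_simps)
  moreover have "\<not> int p dvd v" using v uv(3) by (intro not_dvd_of_mem) simp
  ultimately have "int p dvd (c - 1)" using prime_dvd_multD[OF pp] by blast
  moreover have "\<not> int p dvd (c - 1)" if "c \<noteq> 1"
    using that cd(2) by (intro not_dvd_of_mem) simp
  ultimately have c: "c = 1" by blast
  have "\<phi> a \<otimes>\<^bsub>?A\<^esub> \<phi> a = \<one>\<^bsub>?A\<^esub>" using a by (metis hom_mult hom_one)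
  then have "int p dvd 2 * d" by (simp add: cd c mult_affine_group one_affine_group dvd_eq_mod_eq_0)
  moreover have "\<not> int p dvd 2"
  proof
    assume "int p dvd 2"
    then have "int p \<le> 2" by (intro zdvd_imp_le) simp_all
    then have "p = 2" using p1 by simp
    then show False using p(2) by simp
  qed
  ultimately have "int p dvd d" using prime_dvd_multD[OF pp] by blast
  moreover have "\<not> int p dvd d" if "d \<noteq> 0"
    using that cd(3) by (intro not_dvd_of_mem) simp
  ultimately have "d = 0" by blast
  then have "\<phi> a = \<phi> \<one>" using cd c by (simp add: one_affine_group)
  then show False using inj_onD[OF \<phi>(2), of a \<one>] a by blast
qed

text \<open>The wreath product has order 2p^2 and its subgroups of index 2 have order p^2, whereas
  p^2 does not divide p(p-1).\<close>

lemma wreath_not_affine: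
  assumes p: "Factorial_Ring.prime p" and W: "G \<cong> wreath_Cp_C2 p"
  shows "\<not> iso_to_subgroup G (affine_group p)"
    and "subgroup K G \<Longrightarrow> card (rcosets K) = 2 \<Longrightarrow> \<not> iso_to_subgroup (G\<lparr>carrier := K\<rparr>) (affine_group p)"
proof -
  have p1: "1 < p" using prime_gt_1_nat[OF p] .
  have "card (carrier (wreath_Cp_C2 p)) = p * p * 2"
    by (simp add: wreath_Cp_C2_def card_cartesian_product card_UNIV_bool)
  then have order: "order G = p * p * 2" using iso_same_card[OF W] by (simp add: order_def)
  have not: "\<not> n dvd (p - 1) * p" if "p * p dvd n" for n
  proof
    assume "n dvd (p - 1) * p"
    then have "p * p dvd (p - 1) * p" using that dvd_trans by blast
    then have "p dvd p - 1" using p1 by simp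
    then show False using p1 by (auto dest: dvd_imp_le)
  qed
  show "\<not> iso_to_subgroup G (affine_group p)"
    using order_dvd_of_iso_to_subgroup[OF group_affine_group[OF p], of G] not[of "order G"]
    by (auto simp: order order_affine_group)
  assume K: "subgroup K G" "card (rcosets K) = 2"
  have "order (G\<lparr>carrier := K\<rparr>) = p * p"
    using lagrange[OF K(1)] K(2) order by (simp add: order_def)
  then show "\<not> iso_to_subgroup (G\<lparr>carrier := K\<rparr>) (affine_group p)"
    using order_dvd_of_iso_to_subgroup[OF group_affine_group[OF p], of "G\<lparr>carrier := K\<rparr>"] not[of "p * p"]
    by (auto simp: order_affine_group)
qed

end

section \<open>The direct product case\<close>

context fixed_point_free_based
begin

lemma subgroup_K: "subgroup K G"
  using K_normal by (rule normal_imp_subgroup)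

lemma group_K: "group (G\<lparr>carrier := K\<rparr>)"
  by (rule subgroup_imp_group[OF subgroup_K])

text \<open>Within K the centralizer of x is only <x>, which meets the kernel of
  \<open>to_affine\<close> trivially. This serves (c) and also rules out (a).\<close>

lemma K_iso_affine: "iso_to_subgroup (G\<lparr>carrier := K\<rparr>) (affine_group p)"
proof (rule iso_to_subgroup_of_inj_hom[OF group_K group_affine_group[OF prime_p]])
  have KG: "g \<in> carrier G" if "g \<in> K" for g using that by (simp add: block_stab_def)
  show hom: "to_affine \<in> hom (G\<lparr>carrier := K\<rparr>) (affine_group p)"
    using to_affine_hom KG by (auto simp: hom_def)
  have "g = \<one>" if g: "g \<in> K" "to_affine g = \<one>\<^bsub>affine_group p\<^esub>" for g
  proof -
    obtain i where "g = x [^] (i::int)"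
      using K_centralizer[OF g(1) to_affine_kernel(1)[OF KG[OF g(1)] g(2)]] by blast
    then show ?thesis using to_affine_kernel(2)[OF KG[OF g(1)] g(2)] by blast
  qed
  then show "inj_on to_affine (carrier (G\<lparr>carrier := K\<rparr>))"
    using inj_on_one_iff'[OF hom group_K group_affine_group[OF prime_p]] by simp
qed

text \<open>\<open>G\<close> acts on \<open>\<langle>x\<rangle>\<close> through the powers of the multiplier of a single \<open>u \<in> T - K\<close>, elements of \<open>K\<close> by the
  even ones. The central \<open>s \<notin> K\<close> shows that this multiplier has odd order.\<close>
lemma odd_card_K:
  assumes s: "s \<in> carrier G" "s \<otimes> x = x \<otimes> s" "s \<notin> K"
  shows "odd (card K)"
proof
  assume "even (card K)"
  interpret KG: group "G\<lparr>carrier := K\<rparr>" by (rule group_K)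
  have "finite K" using finite_subset[OF subgroup.subset[OF subgroup_K] finite_carrier] .
  then obtain h where h: "h \<in> K" "h \<noteq> \<one>" "h [^]\<^bsub>G\<lparr>carrier := K\<rparr>\<^esub> (2::nat) = \<one>"
    using KG.exists_prime_order[of 2] \<open>even (card K)\<close> by (auto simp: order_def)
  have hG: "h \<in> carrier G" using h(1) by (simp add: block_stab_def)
  have hh: "h \<otimes> h = \<one>" using h(3) hG by (simp add: numeral_2_eq_2)
  have "h \<otimes> x \<noteq> x \<otimes> h"
    using K_centralizer[OF h(1)] no_involution_in_powers hh h(2) by blast
  then obtain u where u: "u \<in> T" "u \<otimes> x \<noteq> x \<otimes> u"
    using commute_all[OF x_carrier _ hG] by blast
  then have uG: "u \<in> carrier G" by simp
  have "u \<notin> K" using T_K_centralizes u by blast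
  \<comment> \<open>Both sets have p elements. Hence the elements of \<open>T\<close> outside K are
    exactly the conjugates of u by powers of x, and these all have the multiplier of u.\<close>
  have T0: "{t \<in> T. t \<otimes> x = x \<otimes> t} = T \<inter> K"
    using T_K_centralizes finite_T card_T_K T_noncommuting_orbit(3)[OF x_carrier x_pow u]
    by (intro card_subset_eq[symmetric]) auto
  have mult_one: "[multiplier g = 1] (mod int p)" if "g \<in> carrier G" "g \<otimes> x = x \<otimes> g" for g
    using multiplier_one_iff that by blast
  \<comment> \<open>The parity of j need not be determined by g; existence of some j of the right
    parity is enough and is preserved by products.\<close>
  define W where "W = {g \<in> carrier G. \<exists>j. [multiplier g = multiplier u ^ j] (mod int p) \<and> (g \<in> K \<longleftrightarrow> even j)}"
  have "subgroup W G"
  proof (rule subgroup_of_mult_closed[OF finite_carrier])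
    have "[multiplier \<one> = multiplier u ^ 0] (mod int p) \<and> (\<one> \<in> K \<longleftrightarrow> even (0::nat))"
      using mult_one[of \<one>] x_pow_in_K[of 0] by simp
    then show "\<one> \<in> W" unfolding W_def by blast
    fix a b assume a: "a \<in> W" and b: "b \<in> W"
    obtain j where j: "a \<in> carrier G" "[multiplier a = multiplier u ^ j] (mod int p)" "a \<in> K \<longleftrightarrow> even j"
      using a unfolding W_def by blast
    obtain k where k: "b \<in> carrier G" "[multiplier b = multiplier u ^ k] (mod int p)" "b \<in> K \<longleftrightarrow> even k"
      using b unfolding W_def by blast
    have "[multiplier (a \<otimes> b) = multiplier u ^ (j + k)] (mod int p)"
      using cong_trans[OF multiplier_mult[OF j(1) k(1)] cong_mult[OF j(2) k(2)]] by (simp add: power_add)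
    moreover have "a \<otimes> b \<in> K \<longleftrightarrow> even (j + k)" using K_mult[OF j(1) k(1)] j(3) k(3) by simp
    ultimately show "a \<otimes> b \<in> W" unfolding W_def using j(1) k(1) by blast
  qed (simp add: W_def)
  moreover have "T \<subseteq> W"
  proof
    fix t assume t: "t \<in> T"
    have "\<exists>j. [multiplier t = multiplier u ^ j] (mod int p) \<and> (t \<in> K \<longleftrightarrow> even j)"
    proof (cases "t \<in> K")
      case True
      then show ?thesis using mult_one[of t] T_K_centralizes t by (intro exI[of _ 0]) simp
    next
      case False
      then have "t \<otimes> x \<noteq> x \<otimes> t" using T0 t by blast
      then obtain i where i: "t = x [^] (i::int) \<otimes> u \<otimes> inv (x [^] i)"
        using T_noncommuting_orbit(1)[OF x_carrier x_pow u] t by blast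
      have ux: "u \<otimes> x = x [^] multiplier u \<otimes> u" using multiplier_pow[OF uG, of 1] by simp
      have "x [^] i \<otimes> u \<otimes> x = x [^] multiplier u \<otimes> (x [^] i \<otimes> u)"
        using commute_int_pow[OF _ pow_commute, of i "multiplier u"] uG ux
        by (intro intertwine_mult[of _ _ _ "x [^] multiplier u"]) simp_all
      then have "t \<otimes> x = x [^] multiplier u \<otimes> t"
        unfolding i using uG commute_inv[OF _ pow_commute, of i]
        by (intro intertwine_mult[of "x [^] i \<otimes> u" "inv (x [^] i)" x x]) simp_all
      then have "[multiplier t = multiplier u ^ 1] (mod int p)"
        using multiplier_cong[of t "multiplier u"] t by simp
      then show ?thesis using False by (intro exI[of _ 1]) simp
    qed
    then show "t \<in> W" using t by (simp add: W_def)
  qed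
  ultimately have W: "W = carrier G" by (rule subgroup_of_T)
  have "s \<in> W" "h \<in> W" using s(1) hG W by simp_all
  then obtain j where j: "[multiplier s = multiplier u ^ j] (mod int p)" "odd j"
    using s(3) unfolding W_def by blast
  obtain l where l: "[multiplier h = multiplier u ^ l] (mod int p)"
    using \<open>h \<in> W\<close> unfolding W_def by blast
  \<comment> \<open>The multiplier of s is 1 and s is outside K, so an odd power j of the multiplier
    of u is 1. The multiplier of h is a power of that of u, so its j-th power is 1; its square is 1
    too, and j is odd.\<close>
  have uj: "[multiplier u ^ j = 1] (mod int p)"
    using cong_trans[OF cong_sym[OF j(1)] mult_one[OF s(1,2)]] .
  have h2: "[multiplier h * multiplier h = 1] (mod int p)"
    using cong_trans[OF cong_sym[OF multiplier_mult[OF hG hG]]] mult_one[of \<one>] hh by simp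
  obtain q where q: "j = 2 * q + 1" using j(2) by (auto elim: oddE)
  have "[multiplier h ^ j = (multiplier u ^ l) ^ j] (mod int p)" by (rule cong_pow[OF l])
  also have "(multiplier u ^ l) ^ j = (multiplier u ^ j) ^ l" by (simp add: power_mult[symmetric] mult.commute)
  also have "[(multiplier u ^ j) ^ l = 1] (mod int p)" using cong_pow[OF uj, of l] by simp
  finally have "[multiplier h ^ j = 1] (mod int p)" .
  moreover have "multiplier h ^ j = (multiplier h * multiplier h) ^ q * multiplier h"
    by (simp add: q power_mult power2_eq_square)
  moreover have "[(multiplier h * multiplier h) ^ q * multiplier h = 1 ^ q * multiplier h] (mod int p)"
    using h2 by (intro cong_mult cong_pow) simp_all
  ultimately have "[multiplier h = 1] (mod int p)"
    by (metis cong_sym cong_trans mult_1 power_one)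
  then show False using multiplier_one_iff[OF hG] \<open>h \<otimes> x \<noteq> x \<otimes> h\<close> by blast
qed

text \<open>The involution s is central by \<open>involution_central\<close>, and it lies outside K
  because it moves e to the other orbit; K has index 2, so the two factors give all of G.\<close>

lemma direct_product_if_involution:
  assumes s: "s \<in> carrier G" "s \<otimes> x = x \<otimes> s" "s \<otimes> s = \<one>" "s \<noteq> \<one>"
  shows "generate G {s} \<lhd> G" "K \<inter> generate G {s} = {\<one>}" "K <#> generate G {s} = carrier G"
    and "odd (card K)"
proof -
  have sK: "s \<notin> K" using involution_not_in_orb[OF s e] by (simp add: block_stab_def)
  show "odd (card K)" by (rule odd_card_K[OF s(1,2) sK])
  have gen: "generate G {s} = {\<one>, s}" by (rule generate_involution[OF s(1,3)])
  have one: "\<one> \<in> K" using x_pow_in_K[of 0] by simp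
  show "K \<inter> generate G {s} = {\<one>}" unfolding gen using sK one by blast
  have sub: "subgroup {\<one>, s} G" using generate_is_subgroup[of "{s}"] gen s by simp
  show "generate G {s} \<lhd> G"
    unfolding gen
  proof (rule normal_invI[OF sub])
    fix g h assume "g \<in> carrier G" "h \<in> {\<one>, s}"
    moreover from this have "g \<otimes> s = s \<otimes> g" by (intro involution_central[OF s(1-3)])
    ultimately have "g \<otimes> s \<otimes> inv g = s" using conj_eq_iff[of g s s] s(1) by blast
    then show "g \<otimes> h \<otimes> inv g \<in> {\<one>, s}"
      using \<open>g \<in> carrier G\<close> \<open>h \<in> {\<one>, s}\<close> by auto
  qed
  have "g \<in> K <#> {\<one>, s}" if g: "g \<in> carrier G" for g
  proof (cases "g \<in> K")
    case True
    then have "g \<otimes> \<one> \<in> K <#> {\<one>, s}" unfolding set_mult_def by blast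
    then show ?thesis using g by simp
  next
    case False
    then have "g \<otimes> s \<in> K" using K_mult[OF g s(1)] sK by simp
    then have "g \<otimes> s \<otimes> s \<in> K <#> {\<one>, s}" unfolding set_mult_def by blast
    then show ?thesis using g s by (simp add: m_assoc)
  qed
  then show "K <#> generate G {s} = carrier G"
    unfolding gen using s(1) subgroup.subset[OF subgroup_K] by (auto simp: set_mult_def)
qed

text \<open>A converse, needed to separate (b) from (c). As K has index 2, a^2 lies in K and in <a>,
  so it is trivial. The commutator of a and x lies in both normal subgroups, so it is trivial as
  well.\<close>

lemma commuting_involution_of_direct_product:
  assumes a: "a \<in> carrier G" "generate G {a} \<lhd> G" "K \<inter> generate G {a} = {\<one>}"
    "K <#> generate G {a} = carrier G"
  shows "a \<otimes> a = \<one>" "a \<noteq> \<one>" "a \<otimes> x = x \<otimes> a"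
proof -
  have gen: "a \<in> generate G {a}" by (simp add: generate.incl)
  have sub: "subgroup (generate G {a}) G" using a(2) by (rule normal_imp_subgroup)
  show "a \<noteq> \<one>"
  proof
    assume "a = \<one>"
    then have "K <#> {\<one>} = carrier G" using a(4) generate_one by simp
    moreover have "K <#> {\<one>} = K"
    proof -
      have "k \<otimes> \<one> = k" if "k \<in> K" for k using that subgroup.mem_carrier[OF subgroup_K] by simp
      then show ?thesis unfolding set_mult_def by auto
    qed
    ultimately have "K = carrier G" by simp
    then have "card K = order G" by (simp add: order_def)
    then have "2 * card K = card K" using lagrange[OF subgroup_K] K_index by simp
    then show False using finite_carrier \<open>K = carrier G\<close> one_closed by (auto simp: card_eq_0_iff)
  qed
  have "a \<otimes> a \<in> K \<inter> generate G {a}"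
    using K_mult[OF a(1) a(1)] subgroup.m_closed[OF sub gen gen] by simp
  then show "a \<otimes> a = \<one>" using a(3) by blast
  have xK: "x \<in> K" using x_pow_in_K[of 1] by simp
  have "x \<otimes> a \<otimes> inv x \<in> generate G {a}"
    using normal.inv_op_closed2[OF a(2) x_carrier gen] .
  then have "inv a \<otimes> (x \<otimes> a \<otimes> inv x) \<in> generate G {a}"
    using subgroup.m_closed[OF sub subgroup.m_inv_closed[OF sub gen]] by blast
  moreover have "inv a \<otimes> x \<otimes> a \<in> K"
    using normal.inv_op_closed1[OF K_normal a(1) xK] .
  then have "inv a \<otimes> x \<otimes> a \<otimes> inv x \<in> K"
    using subgroup.m_closed[OF subgroup_K] subgroup.m_inv_closed[OF subgroup_K xK] by blast
  then have "inv a \<otimes> (x \<otimes> a \<otimes> inv x) \<in> K" using a(1) by (simp add: m_assoc)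
  ultimately have "inv a \<otimes> (x \<otimes> a \<otimes> inv x) = \<one>" using a(3) by blast
  then have "x \<otimes> a \<otimes> inv x = a" using a(1) by (simp add: inv_solve_left')
  then show "a \<otimes> x = x \<otimes> a" using a(1) by (simp only: conj_eq_iff x_carrier)
qed

end

section \<open>Classification\<close>

context conj_closed_transversal
begin

lemma permutes_halves_compl: "g \<in> carrier G \<Longrightarrow> permutes_halves D g \<Longrightarrow> permutes_halves (Om - D) g"
proof -
  assume g: "g \<in> carrier G" and "permutes_halves D g"
  then obtain b where b: "\<forall>\<alpha>\<in>Om. (act g \<alpha> \<in> D) = ((\<alpha> \<in> D) = b)"
    unfolding permutes_halves_def by (elim exE)
  have "(act g \<alpha> \<in> Om - D) = ((\<alpha> \<in> Om - D) = b)" if "\<alpha> \<in> Om" for \<alpha>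
    using b[THEN bspec, OF that] that g by (cases b) simp_all
  then show "permutes_halves (Om - D) g" unfolding permutes_halves_def by (intro exI ballI)
qed

theorem classification:
  assumes e: "e \<in> Om"
  shows "\<exists>K. subgroup K G \<and> {g \<in> carrier G. act g e = e} \<subseteq> K \<and> card (rcosets K) = 2 \<and>
     (let ca = G \<cong> wreath_Cp_C2 p;
          cb = iso_to_subgroup G (affine_group p);
          cc = (\<exists>a \<in> carrier G. K \<lhd> G \<and> generate G {a} \<lhd> G
                   \<and> K \<inter> generate G {a} = {\<one>} \<and> K <#> generate G {a} = carrier G)
               \<and> odd (card K) \<and> iso_to_subgroup (G\<lparr>carrier := K\<rparr>) (affine_group p)
      in (ca \<or> cb \<or> cc)
         \<and> ((cb \<or> cc) \<longrightarrow> generate G (T \<inter> K) \<lhd> G \<and> card (generate G (T \<inter> K)) = p)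
         \<and> \<not> (ca \<and> cb) \<and> \<not> (ca \<and> cc) \<and> \<not> (cb \<and> cc))"
proof (cases "\<exists>x\<in>carrier G. x [^] p = \<one> \<and> x \<noteq> \<one> \<and> Fix x \<noteq> {}")
  case True
  then obtain x where x: "x \<in> carrier G" "x [^] p = \<one>" "x \<noteq> \<one>" and ne: "Fix x \<noteq> {}" by blast
  have W: "G \<cong> wreath_Cp_C2 p" and perm: "\<And>g. g \<in> carrier G \<Longrightarrow> permutes_halves (Fix x) g"
    using fixed_point_case[OF x ne] by blast+
  \<comment> \<open>K must contain the stabilizer of e, so D is whichever half contains e.\<close>
  define D where "D = (if e \<in> Fix x then Fix x else Om - Fix x)"
  have "Om - Fix x \<noteq> {}" using Fix_halves(2)[OF x ne] p_ge3 by (metis card.empty not_numeral_le_zero)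
  then obtain f where f: "f \<in> Om" "f \<notin> D"
  proof (cases "e \<in> Fix x")
    case True
    then show thesis using \<open>Om - Fix x \<noteq> {}\<close> that unfolding D_def by auto
  next
    case False
    obtain f where "f \<in> Fix x" using ne by blast
    then show thesis using False that[of f] by (simp add: D_def Fix_def)
  qed
  have eD: "e \<in> D" using e by (simp add: D_def)
  have permD: "permutes_halves D g" if "g \<in> carrier G" for g
    using perm permutes_halves_compl that by (simp add: D_def)
  let ?K = "block_stab e D"
  have K: "?K \<lhd> G" "card (rcosets ?K) = 2"
    using block_stab_index_two[OF permD e eD f] by blast+
  have sub: "subgroup ?K G" using K(1) by (rule normal_imp_subgroup)
  have "{g \<in> carrier G. act g e = e} \<subseteq> ?K" using eD by (auto simp: block_stab_def)
  then show ?thesis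
    using sub K(2) W wreath_not_affine[OF prime_p W] wreath_not_affine(2)[OF prime_p W sub K(2)]
    unfolding Let_def by (intro exI[of _ ?K]) simp
next
  case False
  obtain x where x: "x \<in> carrier G" "x \<noteq> \<one>" "x [^] p = \<one>"
    using exists_prime_order[OF prime_p p_dvd_order finite_carrier] by blast
  interpret X: fixed_point_free_element G act Om T p x
    using x False by unfold_locales auto
  obtain f where f: "f \<in> Om" "f \<notin> X.A.orb e" using X.exists_other_orbit[OF e] .
  interpret X: fixed_point_free_based G act Om T p x e f
    using e f by unfold_locales
  have H: "{g \<in> carrier G. act g e = e} \<subseteq> X.K"
    using X.A.self_in_orb[OF e] by (auto simp: block_stab_def)
  \<comment> \<open>K has index 2 and embeds in Aff(1,p), which is impossible in the wreath product;
    this excludes (a) throughout this branch.\<close>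
  have "\<not> G \<cong> wreath_Cp_C2 p"
    using wreath_not_affine(2)[OF prime_p _ X.subgroup_K X.K_index] X.K_iso_affine by blast
  moreover have "\<not> iso_to_subgroup G (affine_group p)"
    if "a \<in> carrier G" "generate G {a} \<lhd> G" "X.K \<inter> generate G {a} = {\<one>}"
      "X.K <#> generate G {a} = carrier G" for a
    using not_affine_if_commuting_involution[OF prime_p odd_p x(1,3,2) that(1)]
      X.commuting_involution_of_direct_product[OF that] by blast
  \<comment> \<open>Whether the centralizer of x contains an involution decides between (b) and
    (c).\<close>
  moreover have "iso_to_subgroup G (affine_group p) \<or>
      ((\<exists>a \<in> carrier G. X.K \<lhd> G \<and> generate G {a} \<lhd> G
          \<and> X.K \<inter> generate G {a} = {\<one>} \<and> X.K <#> generate G {a} = carrier G) \<and> odd (card X.K))"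
  proof (cases "\<exists>s\<in>carrier G. s \<otimes> x = x \<otimes> s \<and> s \<otimes> s = \<one> \<and> s \<noteq> \<one>")
    case True
    then obtain s where s: "s \<in> carrier G" "s \<otimes> x = x \<otimes> s" "s \<otimes> s = \<one>" "s \<noteq> \<one>" by blast
    then show ?thesis using X.direct_product_if_involution[OF s] X.K_normal by blast
  next
    case False
    then show ?thesis using X.iso_affine_if_no_involution by blast
  qed
  ultimately show ?thesis
    using X.subgroup_K H X.K_index X.generate_T_K X.K_iso_affine unfolding Let_def
    by (intro exI[of _ X.K]) blast
qed

end

section \<open>From the loop to its envelope\<close>

theorem theorem5p13:
  fixes L :: "'a set" and m :: "'a \<Rightarrow> 'a \<Rightarrow> 'a" and e :: 'a and p :: nat
  defines "G \<equiv> env_G L m" and "H \<equiv> env_H L m e" and "T \<equiv> env_T L m"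
  assumes "Factorial_Ring.prime p" and "odd p"
    and "finite L" and "loop L m e" and "card L = 2 * p"
    and "right_conjugacy_closed L m"
  shows "\<exists>K. subgroup K G \<and> H \<subseteq> K \<and> card (rcosets\<^bsub>G\<^esub> K) = 2 \<and>
     (let ca = G \<cong> wreath_Cp_C2 p;
          cb = iso_to_subgroup G (affine_group p);
          cc = (\<exists>a \<in> carrier G. K \<lhd> G \<and> generate G {a} \<lhd> G
                   \<and> K \<inter> generate G {a} = {\<one>\<^bsub>G\<^esub>}
                   \<and> K <#>\<^bsub>G\<^esub> generate G {a} = carrier G)
               \<and> odd (card K) \<and> iso_to_subgroup (G\<lparr>carrier := K\<rparr>) (affine_group p)
      in (ca \<or> cb \<or> cc)
         \<and> ((cb \<or> cc) \<longrightarrow> generate G (T \<inter> K) \<lhd> G \<and> card (generate G (T \<inter> K)) = p)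
         \<and> \<not> (ca \<and> cb) \<and> \<not> (ca \<and> cc) \<and> \<not> (cb \<and> cc))"
proof -
  let ?B = "BijGroup L"
  interpret B: group ?B by (rule group_BijGroup)
  have loop: "e \<in> L" "\<And>x. x \<in> L \<Longrightarrow> m x e = x"
    "\<And>a. a \<in> L \<Longrightarrow> bij_betw (\<lambda>x. m x a) L L" "\<And>a. a \<in> L \<Longrightarrow> bij_betw (\<lambda>x. m a x) L L"
    using \<open>loop L m e\<close> unfolding loop_def by auto
  have T_Bij: "T \<subseteq> carrier ?B"
  proof -
    have "bij_betw (restrict (\<lambda>x. m x a) L) L L" if "a \<in> L" for a
      using loop(3)[OF that] bij_betw_cong[of L "restrict (\<lambda>x. m x a) L" "\<lambda>x. m x a" L] by simp
    then show ?thesis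
      by (auto simp: T_def env_T_def rmult_def BijGroup_def Bij_def)
  qed
  let ?S = "generate ?B T"
  have S: "subgroup ?S ?B" using T_Bij by (rule B.generate_is_subgroup)
  have G: "G = ?B\<lparr>carrier := ?S\<rparr>" by (simp add: G_def T_def env_G_def)
  have carrier: "carrier G = ?S" by (simp add: G)
  have S_Bij: "?S \<subseteq> Bij L" using subgroup.subset[OF S] by (simp add: BijGroup_def)
  have group: "group G" unfolding G by (rule subgroup.subgroup_is_group[OF S group_BijGroup])
  have mult: "(g \<otimes>\<^bsub>G\<^esub> h) \<alpha> = g (h \<alpha>)" if "g \<in> carrier G" "h \<in> carrier G" "\<alpha> \<in> L" for g h \<alpha>
  proof -
    have "g \<in> Bij L" "h \<in> Bij L" using that(1,2) S_Bij unfolding carrier by blast+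
    then have "g \<otimes>\<^bsub>?B\<^esub> h = compose L g h" by (simp add: BijGroup_def)
    moreover have "g \<otimes>\<^bsub>G\<^esub> h = g \<otimes>\<^bsub>?B\<^esub> h" unfolding G by simp
    ultimately show ?thesis using that(3) by (simp add: compose_eq)
  qed
  have one: "\<one>\<^bsub>G\<^esub> = (\<lambda>x\<in>L. x)" by (simp add: G BijGroup_def)
  have bij: "bij_betw g L L" "g \<in> extensional L" if "g \<in> carrier G" for g
    using that S_Bij unfolding carrier Bij_def by blast+
  have finite: "finite (carrier G)"
  proof (rule finite_subset)
    show "carrier G \<subseteq> L \<rightarrow>\<^sub>E L"
      using S_Bij unfolding carrier by (auto simp: PiE_def dest: Bij_imp_funcset Bij_imp_extensional)
    show "finite (L \<rightarrow>\<^sub>E L)" using \<open>finite L\<close> by (intro finite_PiE) auto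
  qed
  interpret G: conj_closed_transversal G "\<lambda>g \<alpha>. g \<alpha>" L T p
  proof (intro conj_closed_transversal.intro[OF group] conj_closed_transversal_axioms.intro)
    show "g \<alpha> \<in> L" if "g \<in> carrier G" "\<alpha> \<in> L" for g \<alpha>
      using bij_betwE[OF bij(1)[OF that(1)]] that(2) by blast
    show "(g \<otimes>\<^bsub>G\<^esub> h) \<alpha> = g (h \<alpha>)" if "g \<in> carrier G" "h \<in> carrier G" "\<alpha> \<in> L" for g h \<alpha>
      using that by (rule mult)
    show "\<one>\<^bsub>G\<^esub> \<alpha> = \<alpha>" if "\<alpha> \<in> L" for \<alpha>
      using that by (simp add: one)
    \<comment> \<open>Elements of \<open>BijGroup L\<close> are extensional, so agreement on L is
      equality.\<close>
    show "g = h" if "g \<in> carrier G" "h \<in> carrier G" "\<And>\<alpha>. \<alpha> \<in> L \<Longrightarrow> g \<alpha> = h \<alpha>" for g h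
      using that bij(2) by (intro extensionalityI[of g L h]) auto
    show "T \<subseteq> carrier G" unfolding carrier by (rule subsetI) (rule generate.incl)
    show "generate G T = carrier G"
      unfolding carrier unfolding G by (rule B.generate_consistent[OF _ S]) (auto intro: generate.incl)
    show "g \<otimes>\<^bsub>G\<^esub> t \<otimes>\<^bsub>G\<^esub> inv\<^bsub>G\<^esub> g \<in> T" if "g \<in> carrier G" "t \<in> T" for g t
      using \<open>right_conjugacy_closed L m\<close> that unfolding right_conjugacy_closed_def G_def T_def by blast
    show "\<exists>!t. t \<in> T \<and> t \<alpha> = \<beta>" if \<alpha>: "\<alpha> \<in> L" and \<beta>: "\<beta> \<in> L" for \<alpha> \<beta>
    proof -
      \<comment> \<open>Sharp transitivity of the right multiplications is bijectivity of the left
        multiplications.\<close>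
      have "bij_betw (m \<alpha>) L L" using loop(4)[OF \<alpha>] by simp
      then obtain a where a: "a \<in> L" "m \<alpha> a = \<beta>" "\<And>b. b \<in> L \<Longrightarrow> m \<alpha> b = \<beta> \<Longrightarrow> b = a"
        using \<beta> unfolding bij_betw_def inj_on_def by (metis imageE)
      show ?thesis
      proof (rule ex1I[of _ "rmult L m a"])
        show "rmult L m a \<in> T \<and> rmult L m a \<alpha> = \<beta>"
          using a(1,2) \<alpha> by (simp add: T_def env_T_def rmult_def)
        fix t assume t: "t \<in> T \<and> t \<alpha> = \<beta>"
        then obtain b where "b \<in> L" "t = rmult L m b" by (auto simp: T_def env_T_def)
        then show "t = rmult L m a" using a(3)[of b] t \<alpha> by (simp add: rmult_def)
      qed
    qed
    have "rmult L m e = (\<lambda>x\<in>L. x)" unfolding rmult_def by (rule restrict_ext) (rule loop(2))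
    then show "\<one>\<^bsub>G\<^esub> \<in> T" using loop(1) by (force simp: one T_def env_T_def)
    show "Factorial_Ring.prime p" "odd p" "finite (carrier G)" "card L = 2 * p"
      by fact+
  qed
  show ?thesis
    using G.classification[OF loop(1)] by (simp add: H_def env_H_def G_def)
qed

end
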